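(* For every positive integer $n$, the coefficients of the inverse Kazhdan--Lusztig polynomial $Q_{F_n}(t)$ of the fan graph $F_n$ form a log-concave sequence with no internal zeros.
   Context: All graphs are finite and loopless (parallel edges allowed). For a graph $G$, $c(G)$ is its number of connected components and $\mathrm{rk}(G)=|V(G)|-c(G)$ is the rank of its graphic matroid $\mathsf{M}(G)$. A composition of $G$ is a partition of $V(G)$ into vertex sets of connected induced subgraphs; $\mathcal{C}(G)$ is the set of compositions and $|C|$ is the number of parts of $C$. Compositions correspond bijectively to flats of $\mathsf{M}(G)$: $C$ corresponds to the set of edges with both endpoints in a common part of $C$. For $C\in\mathcal{C}(G)$, $G[C]$ is the subgraph whose edge set is that flat and whose vertices are the endpoints of these edges, with $\mathrm{rk}(G[C])=|V(G)|-|C|$, and $G/C$ is the graph obtained from $G$ by contracting all edges of that flat. $\chi_G(t)$ is the chromatic polynomial of $G$. The inverse Kazhdan--Lusztig polynomials $Q_G(t)\in\mathbb{Z}[t]$ are uniquely determined by: (i) if $\mathrm{rk}(G)=0$ then $Q_G(t)=1$; (ii) if $\mathrm{rk}(G)>0$ then $\deg Q_G(t)<\frac12\mathrm{rk}(G)$ and $$(-t)^{\mathrm{rk}(G)}Q_G(t^{-1})=\sum_{C\in\mathcal{C}(G)}(-1)^{\mathrm{rk}(G[C])}Q_{G[C]}(t)\cdot t^{|C|}\chi_{G/C}(t^{-1}).$$ For $n\ge1$ the fan graph $F_n$ is the graph on vertices $0,1,\dots,n$ obtained from the path $1,2,\dots,n$ by joining vertex $0$ to every vertex of the path. A real polynomial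 $\sum_{i=0}^{m}a_it^i$ is log-concave if $a_i^2\ge a_{i-1}a_{i+1}$ for all $1\le i\le m-1$; it has no internal zeros if there are no indices $0\le i<j<k\le m$ with $a_i,a_k\ne0$ and $a_j=0$. *)

theory Defs
  imports
    Complex_Main
    "HOL-Library.FuncSet"
    "HOL-Library.Disjoint_Sets"
    "HOL-Computational_Algebra.Polynomial"
begin

section \<open>Finite loopless multigraphs\<close>

text \<open>Edges are abstract names; \<open>ends G e\<close> is the set of endpoints of \<open>e\<close>, so that
  parallel edges are distinct names with the same endpoint set.\<close>

record ('v, 'e) mgraph =
  verts :: "'v set"
  edges :: "'e set"
  ends :: "'e \<Rightarrow> 'v set"

definition loopless_graph :: "('v, 'e) mgraph \<Rightarrow> bool" where
  "loopless_graph G \<longleftrightarrow> finite (verts G) \<and> finite (edges G) \<and>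
     (\<forall>e\<in>edges G. ends G e \<subseteq> verts G \<and> card (ends G e) = 2)"

definition adjacency :: "('v, 'e) mgraph \<Rightarrow> ('v \<times> 'v) set" where
  "adjacency G = {(u, v). \<exists>e\<in>edges G. ends G e = {u, v}}"

definition components :: "('v, 'e) mgraph \<Rightarrow> 'v set set" where
  "components G = verts G // ((adjacency G)\<^sup>* \<inter> verts G \<times> verts G)"

text \<open>The empty graph is not connected.\<close>

definition connected_graph :: "('v, 'e) mgraph \<Rightarrow> bool" where
  "connected_graph G \<longleftrightarrow> card (components G) = 1"

text \<open>The subtraction does not truncate: a finite graph has at most as many components as
  vertices.\<close>

definition rk :: "('v, 'e) mgraph \<Rightarrow> nat" where
  "rk G = card (verts G) - card (components G)"

definition induced_subgraph :: "('v, 'e) mgraph \<Rightarrow> 'v set \<Rightarrow> ('v, 'e) mgraph" where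
  "induced_subgraph G P =
     \<lparr>verts = P, edges = {e \<in> edges G. ends G e \<subseteq> P}, ends = ends G\<rparr>"

section \<open>Compositions, restriction and contraction\<close>

definition compositions :: "('v, 'e) mgraph \<Rightarrow> 'v set set set" where
  "compositions G =
     {C. partition_on (verts G) C \<and> (\<forall>P\<in>C. connected_graph (induced_subgraph G P))}"

definition flat_of :: "('v, 'e) mgraph \<Rightarrow> 'v set set \<Rightarrow> 'e set" where
  "flat_of G C = {e \<in> edges G. \<exists>P\<in>C. ends G e \<subseteq> P}"

text \<open>\<open>G[C]\<close>: vertices not covered by the flat are dropped.\<close>

definition restriction :: "('v, 'e) mgraph \<Rightarrow> 'v set set \<Rightarrow> ('v, 'e) mgraph" where
  "restriction G C =
     \<lparr>verts = (\<Union>e\<in>flat_of G C. ends G e), edges = flat_of G C, ends = ends G\<rparr>"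

text \<open>\<open>G/C\<close>: each part of \<open>C\<close> is connected by edges of the flat, hence is contracted to a
  single vertex, which is represented by the part itself. Parallel edges are kept.\<close>

definition contraction :: "('v, 'e) mgraph \<Rightarrow> 'v set set \<Rightarrow> ('v set, 'e) mgraph" where
  "contraction G C =
     \<lparr>verts = C, edges = edges G - flat_of G C, ends = (\<lambda>e. {P \<in> C. P \<inter> ends G e \<noteq> {}})\<rparr>"

section \<open>The chromatic polynomial\<close>

definition proper_colorings :: "('v, 'e) mgraph \<Rightarrow> nat \<Rightarrow> ('v \<Rightarrow> nat) set" where
  "proper_colorings G k =
     {f \<in> verts G \<rightarrow>\<^sub>E {..<k}. \<forall>e\<in>edges G. \<forall>u v. ends G e = {u, v} \<longrightarrow> f u \<noteq> f v}"

definition chromatic_poly :: "('v, 'e) mgraph \<Rightarrow> int poly" where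
  "chromatic_poly G = (THE p. \<forall>k::nat. poly p (int k) = int (card (proper_colorings G k)))"

section \<open>Inverse Kazhdan--Lusztig polynomials\<close>

abbreviation eval_real :: "int poly \<Rightarrow> real \<Rightarrow> real" where
  "eval_real p x \<equiv> poly (map_poly real_of_int p) x"

text \<open>The defining conditions at a graph \<open>G\<close>. The identity of Laurent polynomials in \<open>t\<close> is
  stated as an identity of functions of a nonzero real variable.\<close>

definition inverse_KL_conditions ::
    "(('v, 'e) mgraph \<Rightarrow> int poly) \<Rightarrow> ('v, 'e) mgraph \<Rightarrow> bool" where
  "inverse_KL_conditions Q G \<longleftrightarrow>
     (rk G = 0 \<longrightarrow> Q G = 1) \<and>
     (rk G > 0 \<longrightarrow>
        real (degree (Q G)) < real (rk G) / 2 \<and>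
        (\<forall>t::real. t \<noteq> 0 \<longrightarrow>
           (- t) ^ rk G * eval_real (Q G) (inverse t) =
           (\<Sum>C\<in>compositions G.
              (- 1) ^ rk (restriction G C) * eval_real (Q (restriction G C)) t *
              (t ^ card C * eval_real (chromatic_poly (contraction G C)) (inverse t)))))"

text \<open>The conditions at a graph involve \<open>Q\<close> only at its restrictions. Therefore they determine
  \<open>Q\<close> on every class of graphs that is closed under restriction, and the value at \<open>G\<close> does not
  depend on the class containing \<open>G\<close>; the class of all finite loopless graphs is one of them.\<close>

definition inverse_KL_poly :: "('v, 'e) mgraph \<Rightarrow> int poly" where
  "inverse_KL_poly G =
     (THE q. \<exists>\<G> Q. G \<in> \<G> \<and>
        (\<forall>H\<in>\<G>. loopless_graph H \<and> (\<forall>C\<in>compositions H. restriction H C \<in> \<G>) \<and>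
           inverse_KL_conditions Q H) \<and>
        q = Q G)"

section \<open>Fan graphs\<close>

definition fan :: "nat \<Rightarrow> (nat, nat set) mgraph" where
  "fan n =
     \<lparr>verts = {0..n},
      edges = {{i, i + 1} | i. 1 \<le> i \<and> i < n} \<union> {{0, i} | i. 1 \<le> i \<and> i \<le> n},
      ends = (\<lambda>e. e)\<rparr>"

section \<open>Coefficient sequences\<close>

definition log_concave_coeffs :: "'a::linordered_idom poly \<Rightarrow> bool" where
  "log_concave_coeffs p \<longleftrightarrow>
     (\<forall>i. 1 \<le> i \<and> i < degree p \<longrightarrow> (coeff p i)\<^sup>2 \<ge> coeff p (i - 1) * coeff p (i + 1))"

definition no_internal_zeros :: "'a::zero poly \<Rightarrow> bool" where
  "no_internal_zeros p \<longleftrightarrow>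
     \<not> (\<exists>i j k. i < j \<and> j < k \<and> k \<le> degree p \<and>
          coeff p i \<noteq> 0 \<and> coeff p j = 0 \<and> coeff p k \<noteq> 0)"

end

theory Submission
  imports Defs "HOL-Computational_Algebra.Formal_Power_Series"
begin

text \<open>The polynomial is explicit. Writing \<open>n = m + 1\<close>, the coefficient of \<open>t\<^sup>j\<close> in
  \<open>Q\<^bsub>F\<^sub>n\<^esub>(t)\<close> is \<open>2\<^bsup>m-2j\<^esup> \<beta>(m, j)\<close> for \<open>2j \<le> m\<close>, where
  \<open>\<beta>(m, j) = C(m, j) - C(m, j-1)\<close> is the number of ballot paths with \<open>m\<close> steps of which \<open>j\<close> go
  down (\<open>inverse_KL_poly_fan\<close>). Since \<open>(m+1) \<beta>(m, j) = (m+1-2j) C(m+1, j)\<close>, the coefficients are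
  positive up to the degree, and they are a product of log-concave sequences: a geometric one, an
  arithmetic one and a row of Pascal's triangle.

  To identify the polynomial, evaluate the defining equation of \<open>Q\<^sub>G\<close> at \<open>t = 1/k\<close> for a positive
  integer \<open>k\<close>. Proper \<open>k\<close>-colourings of \<open>G/C\<close> correspond to those \<open>k\<close>-colourings of \<open>V(G)\<close> whose
  monochromatic edges form exactly the flat of \<open>C\<close>, and every colouring belongs to exactly one
  composition. So the sum over compositions, weighted by chromatic polynomials, becomes
  an unweighted sum over all \<open>k\<close>-colourings \<open>f\<close>: with \<open>M(f)\<close> the set of monochromatic edges,
  the equation at \<open>1/k\<close> says
  \<open>(-1)\<^bsup>rk G\<^esup> k\<^bsup>|V| - rk G\<^esup> Q\<^sub>G(k) = (\<Sum>f. (-k)\<^bsup>rk M(f)\<^esup> Q\<^bsub>M(f)\<^esub>(1/k))\<close>.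
  Both sides of the defining equation are Laurent polynomials, so the values \<open>1/k\<close> suffice
  (\<open>inverse_KL_conditions_by_coloring\<close>).

  For the fan, fix the colour of the hub; a colouring is then a word of length \<open>n\<close> over \<open>k\<close>
  letters. Its monochromatic subgraph splits at the hub and at the places where the word changes:
  a run of \<open>r\<close> letters equal to the hub colour contributes a copy of \<open>F\<^sub>r\<close>, any other run a path,
  whose polynomial is \<open>1\<close>. Summing over words by runs turns the equation for \<open>F\<^sub>n\<close> into an
  identity of generating functions. With \<open>\<Phi>(t, x) = (\<Sum>n. Q\<^bsub>F\<^sub>n\<^esub>(t) x\<^sup>n)\<close> and
  \<open>1/\<Phi> = 1 - (\<Sum>n\<ge>1. r\<^sub>n(t) x\<^sup>n)\<close> it reads
  \<open>t\<^sup>n r\<^sub>n(1/t) - r\<^sub>n(t) = (t - 1) (1 + t)\<^bsup>n-1\<^esup>\<close>. This is solved by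
  \<open>r\<^bsub>m+1\<^esub>(t) = (\<Sum>j\<le>m/2. \<beta>(m, j) t\<^sup>j)\<close> (\<open>height_sum_1_inverse\<close>), and a generating function
  computation with ballot paths then yields the stated coefficients of \<open>\<Phi>\<close>
  (\<open>height_sum_inverse\<close>, \<open>fan_block_sum\<close>).

  The defining conditions have to hold on a class of graphs closed under restriction. One such class
  containing \<open>F\<^sub>n\<close> consists of the subgraphs of \<open>F\<^sub>n\<close> in which the two ends of each path edge are
  either both joined to the hub or both not. Each of them decomposes into fans, glued at the hub, and
  paths; over these blocks ranks add up, while polynomials and the sums over words multiply
  (\<open>sum_words_block_prod\<close>, \<open>admissible_KL\<close>). Conversely the value at a graph without isolated
  vertices is forced: the difference \<open>D\<close> of two solutions that agree on all proper restrictions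
  satisfies \<open>t\<^sup>r D(1/t) = c D(t)\<close> with \<open>deg D < r/2\<close>, so \<open>D = 0\<close> (\<open>inverse_KL_unique\<close>).\<close>

unbundle fps_syntax

section \<open>Evaluation of integer polynomials at real numbers\<close>

lemma eval_real_pCons [simp]: "eval_real (pCons a p) x = of_int a + x * eval_real p x"
  by (simp add: map_poly_pCons)

lemma eval_real_add: "eval_real (p + q) x = eval_real p x + eval_real q x"
proof -
  have "map_poly real_of_int (p + q) = map_poly real_of_int p + map_poly real_of_int q"
    by (rule poly_eqI) (simp add: coeff_map_poly)
  then show ?thesis by simp
qed

lemma eval_real_smult: "eval_real (smult c p) x = of_int c * eval_real p x"
  by (induction p) (auto simp: algebra_simps)

lemma eval_real_mult: "eval_real (p * q) x = eval_real p x * eval_real q x"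
  by (induction p) (auto simp: eval_real_add eval_real_smult algebra_simps)

lemma eval_real_sum: "eval_real (\<Sum>i\<in>A. p i) x = (\<Sum>i\<in>A. eval_real (p i) x)"
  by (induction A rule: infinite_finite_induct) (auto simp: eval_real_add)

lemma eval_real_monom: "eval_real (monom c n) x = of_int c * x ^ n"
  by (simp add: map_poly_monom poly_monom)

section \<open>Weighted ballot paths\<close>

text \<open>The number of lattice paths with \<open>m\<close> unit steps, \<open>j\<close> of them down, that never go below their
  starting height; meaningful for \<open>2j \<le> m + 1\<close> (reflection principle).\<close>

definition ballot :: "nat \<Rightarrow> nat \<Rightarrow> int" where
  "ballot m j = int (m choose j) - (if j = 0 then 0 else int (m choose (j - 1)))"

text \<open>The value \<open>1\<close> at \<open>n = 0\<close> is the polynomial of the one-vertex fan; it makes the products over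
  blocks and the generating function below uniform.\<close>

definition fan_KL :: "nat \<Rightarrow> int poly" where
  "fan_KL n = (if n = 0 then 1 else
     (\<Sum>j\<le>(n - 1) div 2. monom (2 ^ (n - 1 - 2 * j) * ballot (n - 1) j) j))"

text \<open>Total weight of the ballot paths with \<open>m\<close> steps that end at height \<open>h\<close>, where each down step has
  weight \<open>t\<close>. The recursion removes the last step. Keeping the end height as a parameter is what
  makes the generating function of these paths accessible.\<close>

fun path_wt :: "real \<Rightarrow> nat \<Rightarrow> nat \<Rightarrow> real" where
  "path_wt t 0 h = (if h = 0 then 1 else 0)"
| "path_wt t (Suc m) 0 = t * path_wt t m 1"
| "path_wt t (Suc m) (Suc h) = path_wt t m h + t * path_wt t m (Suc (Suc h))"

text \<open>With \<open>u = 2\<close> these are the values of the fan polynomials, with \<open>u = 1\<close> the values of the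
  coefficients \<open>r\<^bsub>m+1\<^esub>\<close> of the reciprocal generating function.\<close>

definition height_sum :: "real \<Rightarrow> real \<Rightarrow> nat \<Rightarrow> real" where
  "height_sum u t m = (\<Sum>h\<le>m. u ^ h * path_wt t m h)"

lemma path_wt_eq_0: "h > m \<Longrightarrow> path_wt t m h = 0"
  by (induction t m h rule: path_wt.induct) auto

text \<open>Appending an up step multiplies the weight by \<open>u\<close>, appending a down step by \<open>t/u\<close>; the correction
  removes the paths at height \<open>0\<close>, which cannot go down.\<close>

lemma height_sum_Suc:
  "u * height_sum u t (Suc m) = (u\<^sup>2 + t) * height_sum u t m - t * path_wt t m 0"
proof -
  have a: "(\<Sum>h\<le>m. u ^ Suc h * path_wt t m (Suc h)) = height_sum u t m - path_wt t m 0"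
  proof -
    have "height_sum u t m = (\<Sum>h\<le>Suc m. u ^ h * path_wt t m h)"
      by (simp add: height_sum_def path_wt_eq_0)
    also have "\<dots> = path_wt t m 0 + (\<Sum>h\<le>m. u ^ Suc h * path_wt t m (Suc h))"
      by (subst sum.atMost_Suc_shift) simp
    finally show ?thesis by simp
  qed
  have b: "(\<Sum>h\<le>m. u ^ Suc (Suc h) * path_wt t m (Suc (Suc h)))
      = height_sum u t m - path_wt t m 0 - u * path_wt t m 1"
  proof -
    have "(\<Sum>h\<le>m. u ^ Suc h * path_wt t m (Suc h)) = (\<Sum>h\<le>Suc m. u ^ Suc h * path_wt t m (Suc h))"
      by (simp add: path_wt_eq_0)
    also have "\<dots> = u * path_wt t m 1 + (\<Sum>h\<le>m. u ^ Suc (Suc h) * path_wt t m (Suc (Suc h)))"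
      by (subst sum.atMost_Suc_shift) simp
    finally show ?thesis using a by simp
  qed
  have "u * height_sum u t (Suc m) =
      u * (t * path_wt t m 1 + (\<Sum>h\<le>m. u ^ Suc h * (path_wt t m h + t * path_wt t m (Suc (Suc h)))))"
    unfolding height_sum_def by (subst sum.atMost_Suc_shift) simp
  also have "\<dots> = u * t * path_wt t m 1 + u\<^sup>2 * height_sum u t m
      + t * (\<Sum>h\<le>m. u ^ Suc (Suc h) * path_wt t m (Suc (Suc h)))"
    by (simp add: height_sum_def algebra_simps sum.distrib sum_distrib_left power2_eq_square)
  also have "\<dots> = (u\<^sup>2 + t) * height_sum u t m - t * path_wt t m 0"
    unfolding b by (simp add: algebra_simps)
  finally show ?thesis .
qed

lemma ballot_Suc: "ballot (Suc m) (Suc j) = ballot m (Suc j) + ballot m j"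
  by (cases j) (auto simp: ballot_def)

text \<open>At \<open>2(j+1) = m+1\<close> the formula vanishes, so the Pascal recursion remains valid at the boundary.\<close>

lemma ballot_middle: "m = 2 * j + 1 \<Longrightarrow> ballot m (Suc j) = 0"
proof -
  assume m: "m = 2 * j + 1"
  have "m choose (Suc j) = m choose j"
    using binomial_symmetric[of "Suc j" m] m by simp
  then show ?thesis by (simp add: ballot_def)
qed

lemma path_wt_closed:
  "path_wt t m h = (if h \<le> m \<and> even (m - h)
     then real_of_int (ballot m ((m - h) div 2)) * t ^ ((m - h) div 2) else 0)"
proof (induction t m h rule: path_wt.induct)
  case (1 t h)
  then show ?case by (auto simp: ballot_def)
next
  case (2 t m)
  show ?case
  proof (cases "odd m")
    case True
    then obtain j where m: "m = 2 * j + 1" by (auto elim: oddE)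
    have *: "ballot (Suc m) (Suc j) = ballot m j"
      using ballot_Suc[of m j] ballot_middle[OF m] by simp
    show ?thesis using 2 m * by simp
  next
    case False
    then show ?thesis using 2 by (cases "m = 0") auto
  qed
next
  case (3 t m h)
  consider "h > m" | "h \<le> m" "odd (m - h)" | "h = m" | "h < m" "even (m - h)"
    by linarith
  then show ?case
  proof cases
    case 1
    then show ?thesis by (simp add: path_wt_eq_0)
  next
    case 2
    have "path_wt t m (Suc (Suc h)) = 0"
      unfolding "3.IH"(2) using 2 by (auto simp: even_diff_nat)
    moreover have "path_wt t m h = 0" using "3.IH"(1) 2 by simp
    ultimately show ?thesis using 2 by simp
  next
    case 3
    then show ?thesis using "3.IH" by (simp add: ballot_def)
  next
    case 4
    then obtain j where j: "m - h = 2 * Suc j"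
      by (metis dvdE gr0_implies_Suc mult_0_right neq0_conv zero_less_diff)
    then have j2: "m - Suc (Suc h) = 2 * j" "Suc (Suc h) \<le> m" by auto
    have "path_wt t m h = real_of_int (ballot m (Suc j)) * t ^ Suc j"
      using "3.IH"(1) j 4 by simp
    moreover have "path_wt t m (Suc (Suc h)) = real_of_int (ballot m j) * t ^ j"
      using "3.IH"(2) j2 by simp
    ultimately show ?thesis using j 4 by (simp add: ballot_Suc algebra_simps)
  qed
qed

lemma eval_fan_KL: "eval_real (fan_KL (Suc m)) t = height_sum 2 t m"
proof -
  have "eval_real (fan_KL (Suc m)) t =
      (\<Sum>j\<le>m div 2. 2 ^ (m - 2 * j) * real_of_int (ballot m j) * t ^ j)"
    by (simp add: fan_KL_def eval_real_sum eval_real_monom)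
  also have "\<dots> = (\<Sum>h\<in>{h. h \<le> m \<and> even (m - h)}. 2 ^ h * path_wt t m h)"
    by (rule sum.reindex_bij_witness[where i="\<lambda>h. (m - h) div 2" and j="\<lambda>j. m - 2 * j"])
      (auto simp: path_wt_closed)
  also have "\<dots> = height_sum 2 t m"
    unfolding height_sum_def
    by (rule sum.mono_neutral_left) (auto simp: path_wt_closed)
  finally show ?thesis .
qed

section \<open>Generating functions of ballot paths\<close>

text \<open>Weights of the paths that return to height \<open>0\<close>, by decomposition at the first return: their
  generating function \<open>D\<close> is the solution of \<open>D = 1 + t x\<^sup>2 D\<^sup>2\<close>.\<close>

fun dyck_wt :: "real \<Rightarrow> nat \<Rightarrow> real" where
  "dyck_wt t 0 = 1"
| "dyck_wt t (Suc 0) = 0"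
| "dyck_wt t (Suc (Suc n)) = t * (\<Sum>i\<le>n. dyck_wt t i * dyck_wt t (n - i))"

lemma dyck_fps: 
  fixes t defines "D \<equiv> Abs_fps (dyck_wt t)"
  shows "D = 1 + fps_const t * fps_X\<^sup>2 * D\<^sup>2"
proof (rule fps_ext)
  fix n
  have *: "fps_const t * fps_X\<^sup>2 * D\<^sup>2 = fps_X ^ 2 * (fps_const t * D\<^sup>2)" by (simp add: mult_ac)
  consider "n = 0" | "n = 1" | m where "n = Suc (Suc m)"
    by (metis One_nat_def not0_implies_Suc)
  then show "D $ n = (1 + fps_const t * fps_X\<^sup>2 * D\<^sup>2) $ n"
  proof cases
    case 3
    have "(fps_X ^ 2 * (fps_const t * D\<^sup>2)) $ n = t * (D * D) $ m"
      unfolding fps_X_power_mult_nth by (simp add: 3 power2_eq_square)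
    also have "\<dots> = D $ n"
      by (simp add: fps_mult_nth D_def 3 atLeast0AtMost)
    finally show ?thesis unfolding * by (simp add: 3)
  qed (unfold *, simp_all add: D_def fps_X_power_mult_nth)
qed

text \<open>A path ending at height \<open>h\<close> splits at its last visits to the heights \<open>0, \<dots>, h-1\<close> into \<open>h + 1\<close>
  returning paths and \<open>h\<close> up steps. The proof only compares recursions: multiplying the equation of
  \<open>D\<close> by \<open>x\<^bsup>h+1\<^esup> D\<^bsup>h+1\<^esup>\<close> gives the recursion of the weights.\<close>

lemma path_wt_fps:
  fixes t defines "D \<equiv> Abs_fps (dyck_wt t)"
  shows "path_wt t m h = (fps_X ^ h * D ^ Suc h) $ m"
proof -
  have D: "D = 1 + fps_const t * fps_X\<^sup>2 * D\<^sup>2" unfolding D_def by (rule dyck_fps)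
  have D1: "D * z = z + fps_const t * fps_X\<^sup>2 * D\<^sup>2 * z" for z
    by (subst D) (simp only: distrib_right mult_1_left)
  have rec: "fps_X ^ Suc h * D ^ Suc (Suc h) =
      fps_X * (fps_X ^ h * D ^ Suc h) + fps_X * (fps_const t * (fps_X ^ Suc (Suc h) * D ^ Suc (Suc (Suc h))))"
    for h
  proof -
    have "fps_X ^ Suc h * D ^ Suc (Suc h) = D * (fps_X ^ Suc h * D ^ Suc h)" by (simp add: mult_ac)
    also have "\<dots> = fps_X ^ Suc h * D ^ Suc h
        + fps_const t * fps_X\<^sup>2 * D\<^sup>2 * (fps_X ^ Suc h * D ^ Suc h)"
      by (rule D1)
    finally show ?thesis by (simp add: power2_eq_square mult_ac)
  qed
  show ?thesis
  proof (induction m arbitrary: h)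
    case 0
    have "D $ 0 = 1" by (simp add: D_def)
    then show ?case by (cases h) (auto simp: fps_X_power_mult_nth)
  next
    case (Suc m)
    show ?case
    proof (cases h)
      case 0
      have e: "1 + fps_X * (fps_const t * (fps_X ^ 1 * D ^ Suc 1)) = 1 + fps_const t * fps_X\<^sup>2 * D\<^sup>2"
        by (simp add: power2_eq_square mult_ac)
      have "D = 1 + fps_X * (fps_const t * (fps_X ^ 1 * D ^ Suc 1))"
        unfolding e by (rule D)
      then have "D $ Suc m = (1 + fps_X * (fps_const t * (fps_X ^ 1 * D ^ Suc 1))) $ Suc m"
        by (rule arg_cong)
      also have "\<dots> = t * (fps_X ^ 1 * D ^ Suc 1) $ m"
        by (simp del: power_Suc power_one_right)
      finally show ?thesis unfolding 0 using Suc[of 1] by simp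
    next
      case h: (Suc h')
      show ?thesis unfolding h
        by (subst rec) (simp add: Suc.IH del: power_Suc)
    qed
  qed
qed

text \<open>The recursion of the height sums as a linear equation; its right-hand side contains only \<open>D\<close>, so
  that the series for different \<open>u\<close> can be compared.\<close>

lemma height_sum_fps:
  "Abs_fps (height_sum u t) * (fps_const u - fps_X * fps_const (u\<^sup>2 + t))
     = fps_const u - fps_X * (fps_const t * Abs_fps (dyck_wt t))"
proof (rule fps_ext)
  fix n
  have *: "A * (fps_const u - fps_X * fps_const c) = A * fps_const u - fps_X * (A * fps_const c)"
    for A :: "real fps" and c by (simp add: algebra_simps)
  show "(Abs_fps (height_sum u t) * (fps_const u - fps_X * fps_const (u\<^sup>2 + t))) $ n
     = (fps_const u - fps_X * (fps_const t * Abs_fps (dyck_wt t))) $ n"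
  proof (cases n)
    case 0
    then show ?thesis unfolding * by (simp add: height_sum_def)
  next
    case (Suc m)
    have "path_wt t m 0 = dyck_wt t m" by (simp add: path_wt_fps)
    then show ?thesis unfolding * using height_sum_Suc[of u t m]
      by (simp add: Suc algebra_simps)
  qed
qed

text \<open>The reciprocal of the fan generating function. Substituting \<open>y = t x D\<close>, which satisfies
  \<open>x y\<^sup>2 = y - t x\<close>, makes \<open>H\<^sub>1\<close> and \<open>H\<^sub>2\<close> rational in \<open>x\<close> and \<open>y\<close>; the claim is
  \<open>H\<^sub>2 - H\<^sub>1 = x H\<^sub>1 H\<^sub>2\<close>, which is checked after multiplication with both denominators.\<close>

lemma height_sum_inverse:
  "(1 + fps_X * Abs_fps (height_sum 2 t)) * (1 - fps_X * Abs_fps (height_sum 1 t)) = 1"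
proof -
  define D where "D = Abs_fps (dyck_wt t)"
  define c where "c = fps_const t"
  define H1 where "H1 = Abs_fps (height_sum 1 t)"
  define H2 where "H2 = Abs_fps (height_sum 2 t)"
  (* The substitution that makes both series rational. *)
  define y where "y = c * fps_X * D"
  have D: "D = 1 + c * fps_X\<^sup>2 * D\<^sup>2" unfolding D_def c_def by (rule dyck_fps)
  have y: "fps_X * y\<^sup>2 = y - c * fps_X"
  proof -
    have "y = c * fps_X * (1 + c * fps_X\<^sup>2 * D\<^sup>2)"
      unfolding y_def by (rule arg_cong[OF D])
    then have "y = c * fps_X + fps_X * (c * fps_X * D)\<^sup>2"
      unfolding power2_eq_square by (simp only: algebra_simps mult_1_left mult_1_right)
    then show ?thesis unfolding y_def by (simp only: eq_diff_eq add.commute)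
  qed
  define P where "P = 1 - fps_X * (1 + c)"
  define R where "R = 2 - fps_X * (4 + c)"
  have e1: "H1 * P = 1 - y"
    using height_sum_fps[of 1 t]
    by (simp add: H1_def P_def y_def c_def D_def fps_const_add[symmetric] mult_ac del: fps_const_add)
  have e2: "H2 * R = 2 - y"
    using height_sum_fps[of 2 t]
    by (simp add: H2_def R_def y_def c_def D_def fps_const_add[symmetric] numeral_fps_const mult_ac del: fps_const_add)
  have nz: "P \<noteq> 0" "R \<noteq> 0"
  proof -
    have "P $ 0 = 1" "R $ 0 = 2" by (simp_all add: P_def R_def)
    then show "P \<noteq> 0" "R \<noteq> 0" by auto
  qed
  have "(H2 - H1 - fps_X * H1 * H2) * (P * R) = (H2 * R) * P - (H1 * P) * R - fps_X * (H1 * P) * (H2 * R)"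
    by (simp add: algebra_simps)
  also have "\<dots> = (2 - y) * P - (1 - y) * R - fps_X * (1 - y) * (2 - y)"
    unfolding e1 e2 ..
  also have "\<dots> = y - c * fps_X - fps_X * y\<^sup>2"
    unfolding P_def R_def by (simp add: algebra_simps power2_eq_square)
  also have "\<dots> = 0" using y by simp
  finally have "H2 - H1 - fps_X * H1 * H2 = 0" using nz by simp
  moreover have "(1 + fps_X * H2) * (1 - fps_X * H1) = 1 + fps_X * (H2 - H1 - fps_X * H1 * H2)"
    by (simp add: algebra_simps)
  ultimately show ?thesis unfolding H1_def[symmetric] H2_def[symmetric] by simp
qed

text \<open>A path to height \<open>h\<close> with \<open>j\<close> down steps has \<open>m = h + 2j\<close> steps, so replacing \<open>t\<close> by \<open>1/t\<close> changes
  its weight from \<open>t\<^sup>j\<close> to \<open>t\<^bsup>h+j-m\<^esup>\<close>.\<close>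

lemma path_wt_inverse:
  "t \<noteq> 0 \<Longrightarrow> t ^ m * path_wt (inverse t) m h = t ^ h * path_wt t m h"
proof (induction t m h rule: path_wt.induct)
  case (2 t m)
  have "t ^ Suc m * path_wt (inverse t) (Suc m) 0 = t ^ m * path_wt (inverse t) m 1"
    using 2(2) by (simp add: field_simps)
  with 2 show ?case by simp
next
  case (3 t m h)
  have "t ^ Suc m * path_wt (inverse t) (Suc m) (Suc h) =
      t * (t ^ m * path_wt (inverse t) m h) + t ^ m * path_wt (inverse t) m (Suc (Suc h))"
    using 3(3) by (simp add: field_simps)
  with 3 show ?case by (simp add: algebra_simps)
qed simp

text \<open>The functional equation \<open>t\<^sup>n r\<^sub>n(1/t) - r\<^sub>n(t) = (t - 1) (1 + t)\<^bsup>n-1\<^esup>\<close>. Both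
  terms satisfy the same recursion up to the contribution of height \<open>0\<close>, and these contributions
  cancel.\<close>

lemma height_sum_1_inverse:
  assumes "t \<noteq> 0"
  shows "t ^ Suc m * height_sum 1 (inverse t) m - height_sum 1 t m = (t - 1) * (1 + t) ^ m"
proof (induction m)
  case 0
  then show ?case by (simp add: height_sum_def)
next
  case (Suc m)
  have p: "t ^ m * path_wt (inverse t) m 0 = path_wt t m 0"
    using path_wt_inverse[OF assms, of m 0] by simp
  have "t ^ Suc (Suc m) * height_sum 1 (inverse t) (Suc m)
      = t ^ Suc m * (t * (1 + inverse t) * height_sum 1 (inverse t) m - t * inverse t * path_wt (inverse t) m 0)"
  proof -
    have rec: "height_sum 1 (inverse t) (Suc m)
        = (1 + inverse t) * height_sum 1 (inverse t) m - inverse t * path_wt (inverse t) m 0"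
      using height_sum_Suc[of 1 "inverse t" m] by simp
    show ?thesis unfolding rec by (simp add: algebra_simps)
  qed
  also have "t * inverse t = 1" using assms by simp
  also have "t * (1 + inverse t) = 1 + t" using assms by (simp add: field_simps)
  also have "t ^ Suc m * ((1 + t) * height_sum 1 (inverse t) m - 1 * path_wt (inverse t) m 0) =
     (1 + t) * (t ^ Suc m * height_sum 1 (inverse t) m) - t * path_wt t m 0"
    unfolding p[symmetric] by (simp add: algebra_simps)
  finally have "t ^ Suc (Suc m) * height_sum 1 (inverse t) (Suc m) - height_sum 1 t (Suc m) =
     (1 + t) * (t ^ Suc m * height_sum 1 (inverse t) m - height_sum 1 t m)"
    using height_sum_Suc[of 1 t m] by (simp add: algebra_simps)
  then show ?case unfolding Suc by simp
qed

text \<open>The scaling parameter \<open>s\<close> is needed because the fan equation relates the series at \<open>(k, -x)\<close> and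
  at \<open>(1/k, -k x)\<close>.\<close>

lemma fan_KL_fps_inverse:
  "Abs_fps (\<lambda>n. eval_real (fan_KL n) t * s ^ n) *
     (1 - Abs_fps (\<lambda>n. case n of 0 \<Rightarrow> 0 | Suc m \<Rightarrow> height_sum 1 t m * s ^ Suc m)) = 1"
proof -
  let ?X = "fps_const s * fps_X"
  have X: "?X $ 0 = 0" by simp
  have a: "(1 + fps_X * Abs_fps (height_sum 2 t)) oo ?X = Abs_fps (\<lambda>n. eval_real (fan_KL n) t * s ^ n)"
    unfolding fps_compose_linear
  proof (rule fps_ext)
    fix n show "Abs_fps (\<lambda>n. s ^ n * (1 + fps_X * Abs_fps (height_sum 2 t)) $ n) $ n =
        Abs_fps (\<lambda>n. eval_real (fan_KL n) t * s ^ n) $ n"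
    proof (cases n)
      case 0
      then show ?thesis by (simp add: fan_KL_def)
    next
      case (Suc m)
      then show ?thesis by (simp add: eval_fan_KL)
    qed
  qed
  have b: "(1 - fps_X * Abs_fps (height_sum 1 t)) oo ?X
      = 1 - Abs_fps (\<lambda>n. case n of 0 \<Rightarrow> 0 | Suc m \<Rightarrow> height_sum 1 t m * s ^ Suc m)"
    unfolding fps_compose_linear by (rule fps_ext) (auto split: nat.splits)
  have "((1 + fps_X * Abs_fps (height_sum 2 t)) oo ?X) * ((1 - fps_X * Abs_fps (height_sum 1 t)) oo ?X)
     = 1 oo ?X"
    unfolding fps_compose_mult_distrib[OF X, symmetric] height_sum_inverse ..
  then show ?thesis unfolding a b fps_compose_1 .
qed

section \<open>Log-concavity of the coefficients\<close>

text \<open>The form of the ballot numbers from which positivity and log-concavity can be read off.\<close>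

lemma ballot_times: "int (Suc m) * ballot m j = (int (Suc m) - 2 * int j) * int (Suc m choose j)"
proof (cases j)
  case 0
  then show ?thesis by (simp add: ballot_def)
next
  case (Suc i)
  have 1: "int (Suc i) * int (Suc m choose Suc i) = int (Suc m) * int (m choose i)"
    using Suc_times_binomial_eq[of m i] by (metis mult.commute of_nat_mult)
  have 2: "int (Suc m choose Suc i) = int (m choose i) + int (m choose Suc i)" by simp
  have "int (Suc m) * ballot m j = int (Suc m) * (int (Suc m choose Suc i) - 2 * int (m choose i))"
    unfolding Suc ballot_def 2 by simp
  also have "\<dots> = int (Suc m) * int (Suc m choose Suc i) - 2 * (int (Suc i) * int (Suc m choose Suc i))"
    unfolding 1 by (simp only: algebra_simps)
  finally show ?thesis unfolding Suc by (simp only: algebra_simps)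
qed

lemma ballot_pos: "2 * j \<le> m \<Longrightarrow> ballot m j > 0"
proof -
  assume j: "2 * j \<le> m"
  have "int (Suc m) * ballot m j > 0"
    unfolding ballot_times using j by (intro mult_pos_pos) auto
  then show ?thesis by (simp add: zero_less_mult_iff)
qed

text \<open>The quotient \<open>C(n, j+1) / C(n, j) = (n - j) / (j + 1)\<close> decreases with \<open>j\<close>.\<close>

lemma binomial_log_concave: "(n choose j) * (n choose Suc (Suc j)) \<le> (n choose Suc j)\<^sup>2"
proof (cases "Suc j \<le> n")
  case True
  define a b c where "a = n choose j" and "b = n choose Suc j" and "c = n choose Suc (Suc j)"
  have ab: "Suc j * b = (n - j) * a" and bc: "Suc (Suc j) * c = (n - Suc j) * b"
    unfolding a_def b_def c_def by (metis binomial_absorb_comp binomial_absorption mult.commute Suc_times_binomial_eq)+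
  have "((n - j) * Suc (Suc j)) * (a * c) = ((n - j) * a) * (Suc (Suc j) * c)" by (simp only: mult_ac)
  also have "\<dots> = (Suc j * (n - Suc j)) * b\<^sup>2"
    unfolding ab[symmetric] bc power2_eq_square by (simp only: mult_ac)
  also have "\<dots> \<le> ((n - j) * Suc (Suc j)) * b\<^sup>2"
    by (intro mult_le_mono1) (simp only: mult.commute[of "Suc j"], intro mult_le_mono, auto)
  finally show ?thesis using True unfolding a_def b_def c_def by simp
next
  case False
  then show ?thesis by (simp add: binomial_eq_0)
qed

lemma ballot_log_concave:
  assumes "1 \<le> j" "2 * (j + 1) \<le> m"
  shows "ballot m (j - 1) * ballot m (j + 1) \<le> (ballot m j)\<^sup>2"
proof -
  obtain i where j: "j = Suc i" using assms(1) by (cases j) auto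
  define M where "M = int (Suc m)"
  have "M > 0" by (simp add: M_def)
  have "M\<^sup>2 * (ballot m (j - 1) * ballot m (j + 1)) = (M * ballot m i) * (M * ballot m (Suc (Suc i)))"
    by (simp add: j power2_eq_square)
  also have "\<dots> = ((M - 2 * int i) * (M - 2 * int (Suc (Suc i)))) *
      int ((Suc m choose i) * (Suc m choose Suc (Suc i)))"
    unfolding M_def ballot_times by (simp only: of_nat_mult mult_ac)
  also have "\<dots> \<le> (M - 2 * int (Suc i))\<^sup>2 * int ((Suc m choose Suc i)\<^sup>2)"
  proof (rule mult_mono)
    show "(M - 2 * int i) * (M - 2 * int (Suc (Suc i))) \<le> (M - 2 * int (Suc i))\<^sup>2"
      by (simp add: power2_eq_square algebra_simps)
    show "int ((Suc m choose i) * (Suc m choose Suc (Suc i))) \<le> int ((Suc m choose Suc i)\<^sup>2)"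
      using binomial_log_concave by (simp only: of_nat_le_iff)
  qed auto
  also have "\<dots> = M\<^sup>2 * (ballot m j)\<^sup>2"
    unfolding j power_mult_distrib[symmetric] M_def ballot_times by (simp add: power_mult_distrib)
  finally show ?thesis using \<open>M > 0\<close> by (simp add: mult_le_cancel_left)
qed

lemma coeff_fan_KL:
  "coeff (fan_KL (Suc m)) j = (if 2 * j \<le> m then 2 ^ (m - 2 * j) * ballot m j else 0)"
proof -
  have "coeff (fan_KL (Suc m)) j = (\<Sum>i\<le>m div 2. if i = j then 2 ^ (m - 2 * i) * ballot m i else 0)"
    by (simp add: fan_KL_def coeff_sum)
  then show ?thesis by auto
qed

lemma degree_fan_KL: "2 * degree (fan_KL n) \<le> n - 1"
proof (cases n)
  case 0
  then show ?thesis by (simp add: fan_KL_def)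
next
  case (Suc m)
  have "degree (fan_KL n) \<le> m div 2"
    unfolding Suc by (rule degree_le) (auto simp: coeff_fan_KL)
  then show ?thesis using Suc by simp
qed

lemma log_concave_fan_KL: "log_concave_coeffs (fan_KL n)"
proof (cases n)
  case 0
  then show ?thesis by (simp add: fan_KL_def log_concave_coeffs_def)
next
  case (Suc m)
  show ?thesis unfolding log_concave_coeffs_def
  proof (intro allI impI)
    fix j assume j: "1 \<le> j \<and> j < degree (fan_KL n)"
    then have le: "2 * (j + 1) \<le> m" using degree_fan_KL[of n] Suc by simp
    obtain e where m: "m = 2 * (j + 1) + e" using le by (metis le_Suc_ex)
    obtain i where i: "j = Suc i" using j by (cases j) auto
    have "coeff (fan_KL n) (j - 1) * coeff (fan_KL n) (j + 1)
        = (2 ^ (e + 2))\<^sup>2 * (ballot m (j - 1) * ballot m (j + 1))"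
      unfolding Suc coeff_fan_KL using m i by (simp add: power_add power2_eq_square)
    also have "\<dots> \<le> (2 ^ (e + 2))\<^sup>2 * (ballot m j)\<^sup>2"
      using ballot_log_concave[OF _ le] j by (intro mult_left_mono) auto
    also have "\<dots> = (coeff (fan_KL n) j)\<^sup>2"
      unfolding Suc coeff_fan_KL using m by (simp add: power_mult_distrib)
    finally show "coeff (fan_KL n) (j - 1) * coeff (fan_KL n) (j + 1) \<le> (coeff (fan_KL n) j)\<^sup>2" .
  qed
qed

lemma no_internal_zeros_fan_KL: "no_internal_zeros (fan_KL n)"
proof (cases n)
  case 0
  then show ?thesis by (simp add: fan_KL_def no_internal_zeros_def)
next
  case (Suc m)
  have "coeff (fan_KL n) j \<noteq> 0" if "j \<le> degree (fan_KL n)" for j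
    using that degree_fan_KL[of n] ballot_pos[of j m] by (simp add: Suc coeff_fan_KL)
  then show ?thesis unfolding no_internal_zeros_def by (meson less_imp_le order.trans)
qed

section \<open>Colourings and partitions\<close>

definition mono_on_set :: "('v \<Rightarrow> 'c) \<Rightarrow> 'v set \<Rightarrow> bool" where
  "mono_on_set f S \<longleftrightarrow> (\<forall>u\<in>S. \<forall>v\<in>S. f u = f v)"

definition mono_edges :: "('v, 'e) mgraph \<Rightarrow> ('v \<Rightarrow> 'c) \<Rightarrow> 'e set" where
  "mono_edges G f = {e \<in> edges G. mono_on_set f (ends G e)}"

lemma mono_on_setD: "mono_on_set f S \<Longrightarrow> u \<in> S \<Longrightarrow> v \<in> S \<Longrightarrow> f u = f v"
  unfolding mono_on_set_def by blast

lemma mono_on_set_subset: "mono_on_set f T \<Longrightarrow> S \<subseteq> T \<Longrightarrow> mono_on_set f S"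
  unfolding mono_on_set_def by blast

lemma partition_unique_part:
  "partition_on V C \<Longrightarrow> P \<in> C \<Longrightarrow> P' \<in> C \<Longrightarrow> v \<in> P \<Longrightarrow> v \<in> P' \<Longrightarrow> P = P'"
  by (auto simp: partition_on_def disjoint_def)

text \<open>On the level of colourings this is contraction: \<open>C\<close> is the vertex set of the contracted graph.\<close>

lemma bij_betw_colorings_parts:
  fixes C :: "'v set set" and S :: "'c set"
  assumes C: "partition_on V C"
  defines "\<Phi> \<equiv> \<lambda>g. \<lambda>v\<in>V. g (THE P. P \<in> C \<and> v \<in> P)"
  shows "bij_betw \<Phi> (C \<rightarrow>\<^sub>E S) {f \<in> V \<rightarrow>\<^sub>E S. \<forall>P\<in>C. mono_on_set f P}"
    and "P \<in> C \<Longrightarrow> v \<in> P \<Longrightarrow> \<Phi> g v = g P"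
proof -
  have the: "(THE P. P \<in> C \<and> v \<in> P) = P" if "P \<in> C" "v \<in> P" for P v
    using that partition_unique_part[OF C] by (intro the_equality) blast+
  have V: "\<And>v. v \<in> V \<longleftrightarrow> (\<exists>P\<in>C. v \<in> P)" using C by (auto simp: partition_on_def)
  show val: "\<Phi> g v = g P" if "P \<in> C" "v \<in> P" for g P v
    using that the V by (auto simp: \<Phi>_def)
  have ne: "P \<noteq> {}" if "P \<in> C" for P using that C by (auto simp: partition_on_def)
  then have some: "(SOME v. v \<in> P) \<in> P" if "P \<in> C" for P using that by (simp add: some_in_eq)
  show "bij_betw \<Phi> (C \<rightarrow>\<^sub>E S) {f \<in> V \<rightarrow>\<^sub>E S. \<forall>P\<in>C. mono_on_set f P}"
  proof (rule bij_betwI[where g="\<lambda>f. \<lambda>P\<in>C. f (SOME v. v \<in> P)"])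
    show "\<Phi> \<in> (C \<rightarrow>\<^sub>E S) \<rightarrow> {f \<in> V \<rightarrow>\<^sub>E S. \<forall>P\<in>C. mono_on_set f P}"
    proof
      fix g assume g: "g \<in> C \<rightarrow>\<^sub>E S"
      have "\<Phi> g \<in> V \<rightarrow>\<^sub>E S"
      proof (rule PiE_I)
        fix v assume "v \<in> V"
        then obtain P where "P \<in> C" "v \<in> P" using V by blast
        then show "\<Phi> g v \<in> S" using val g by (auto simp: PiE_def)
      qed (simp add: \<Phi>_def)
      then show "\<Phi> g \<in> {f \<in> V \<rightarrow>\<^sub>E S. \<forall>P\<in>C. mono_on_set f P}"
        by (auto simp: mono_on_set_def val)
    qed
    show "(\<lambda>f. \<lambda>P\<in>C. f (SOME v. v \<in> P)) \<in> {f \<in> V \<rightarrow>\<^sub>E S. \<forall>P\<in>C. mono_on_set f P} \<rightarrow> C \<rightarrow>\<^sub>E S"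
    proof (intro Pi_I PiE_I)
      fix f P assume f: "f \<in> {f \<in> V \<rightarrow>\<^sub>E S. \<forall>P\<in>C. mono_on_set f P}" and P: "P \<in> C"
      have "(SOME v. v \<in> P) \<in> V" using some[OF P] P V by blast
      then show "(\<lambda>P\<in>C. f (SOME v. v \<in> P)) P \<in> S" using f P by auto
    qed simp
    show "(\<lambda>P\<in>C. \<Phi> g (SOME v. v \<in> P)) = g" if "g \<in> C \<rightarrow>\<^sub>E S" for g
    proof
      fix P show "(\<lambda>P\<in>C. \<Phi> g (SOME v. v \<in> P)) P = g P"
        using that some val by (cases "P \<in> C") (auto simp: PiE_def extensional_def)
    qed
    show "\<Phi> (\<lambda>P\<in>C. f (SOME v. v \<in> P)) = f"
      if f: "f \<in> {f \<in> V \<rightarrow>\<^sub>E S. \<forall>P\<in>C. mono_on_set f P}" for f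
    proof
      fix v
      show "\<Phi> (\<lambda>P\<in>C. f (SOME v. v \<in> P)) v = f v"
      proof (cases "v \<in> V")
        case True
        then obtain P where P: "P \<in> C" "v \<in> P" using V by blast
        then have "f (SOME v. v \<in> P) = f v"
          using f by (intro mono_on_setD[OF _ some[OF P(1)] P(2)]) simp
        then show ?thesis using val[OF P] P by simp
      next
        case False
        then show ?thesis using f by (auto simp: \<Phi>_def PiE_def extensional_def)
      qed
    qed
  qed
qed

lemma finite_part: "finite V \<Longrightarrow> partition_on V C \<Longrightarrow> finite C"
  using finite_elements by blast

lemma card_colorings_parts:
  assumes "partition_on V C" "finite V"
  shows "card {f \<in> V \<rightarrow>\<^sub>E {..<k::nat}. \<forall>P\<in>C. mono_on_set f P} = k ^ card C"
proof -
  have "card {f \<in> V \<rightarrow>\<^sub>E {..<k}. \<forall>P\<in>C. mono_on_set f P} = card (C \<rightarrow>\<^sub>E {..<k})"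
    using bij_betw_same_card[OF bij_betw_colorings_parts(1)[OF assms(1)]] by metis
  also have "\<dots> = k ^ card C" using finite_part[OF assms(2,1)] by (simp add: card_PiE)
  finally show ?thesis .
qed

lemma equiv_connectivity: "equiv V ((adjacency G)\<^sup>* \<inter> V \<times> V)"
proof (rule equivI)
  have "sym (adjacency G)" by (auto simp: adjacency_def sym_def insert_commute)
  then have "sym ((adjacency G)\<^sup>*)" by (rule sym_rtrancl)
  then show "sym ((adjacency G)\<^sup>* \<inter> V \<times> V)" by (auto simp: sym_def)
  show "trans ((adjacency G)\<^sup>* \<inter> V \<times> V)" by (auto simp: trans_def)
qed (auto simp: refl_on_def)

lemma partition_on_components: "partition_on (verts G) (components G)"
  unfolding components_def by (rule partition_on_quotient[OF equiv_connectivity])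

lemma mono_on_component:
  assumes "\<And>e. e \<in> edges G \<Longrightarrow> mono_on_set f (ends G e)" "P \<in> components G"
  shows "mono_on_set f P"
proof -
  have step: "f x = f y" if "(x, y) \<in> (adjacency G)\<^sup>*" for x y
    using that
  proof induction
    case (step y z)
    then obtain e where e: "e \<in> edges G" "ends G e = {y, z}" by (auto simp: adjacency_def)
    have "f y = f z" by (rule mono_on_setD[OF assms(1)[OF e(1)]]) (simp_all add: e)
    then show ?case using step by simp
  qed simp
  obtain x where "P = ((adjacency G)\<^sup>* \<inter> verts G \<times> verts G) `` {x}"
    using assms(2) unfolding components_def by (rule quotientE)
  then have "f v = f x" if "v \<in> P" for v using that step by auto
  then show ?thesis by (simp add: mono_on_set_def)
qed

lemma loopless_ends:
  assumes "loopless_graph G" "e \<in> edges G"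
  obtains a b where "a \<noteq> b" "ends G e = {a, b}" "a \<in> verts G" "b \<in> verts G"
  using assms unfolding loopless_graph_def by (fastforce simp: card_2_iff)

lemma edge_in_component:
  assumes "loopless_graph G" "e \<in> edges G"
  shows "\<exists>P\<in>components G. ends G e \<subseteq> P"
proof -
  obtain a b where e: "ends G e = {a, b}" "a \<in> verts G" "b \<in> verts G"
    using loopless_ends[OF assms] by metis
  let ?r = "(adjacency G)\<^sup>* \<inter> verts G \<times> verts G"
  have "(a, b) \<in> adjacency G" using e assms(2) by (auto simp: adjacency_def)
  then have "ends G e \<subseteq> ?r `` {a}" using e by auto
  moreover have "?r `` {a} \<in> components G" unfolding components_def using e by (intro quotientI)
  ultimately show ?thesis by blast
qed

text \<open>Counting colourings gives access to the number of components, and hence to the rank, without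
  spanning forests; all ranks below are found in this way.\<close>

lemma card_colorings_components:
  assumes "loopless_graph G"
  shows "card {f \<in> verts G \<rightarrow>\<^sub>E {..<k::nat}. \<forall>e\<in>edges G. mono_on_set f (ends G e)}
    = k ^ card (components G)"
proof -
  have "(\<forall>e\<in>edges G. mono_on_set f (ends G e)) \<longleftrightarrow> (\<forall>P\<in>components G. mono_on_set f P)"
    for f :: "'a \<Rightarrow> nat"
    using mono_on_component[of G f] edge_in_component[OF assms] mono_on_set_subset[of f] by metis
  then show ?thesis
    using card_colorings_parts[OF partition_on_components[of G], of k] assms
    by (simp add: loopless_graph_def)
qed

section \<open>Compositions and flats\<close>

lemma mono_on_connected:
  assumes "connected_graph (induced_subgraph G P)"
    and "\<And>e. e \<in> edges G \<Longrightarrow> ends G e \<subseteq> P \<Longrightarrow> mono_on_set f (ends G e)"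
  shows "mono_on_set f P"
proof -
  let ?H = "induced_subgraph G P"
  obtain Q where Q: "components ?H = {Q}"
    using assms(1) unfolding connected_graph_def by (rule card_1_singletonE)
  have "Q = P" using partition_on_components[of ?H] unfolding Q
    by (auto simp: partition_on_def induced_subgraph_def)
  moreover have "mono_on_set f Q"
    by (rule mono_on_component[of ?H]) (use assms(2) Q in \<open>auto simp: induced_subgraph_def\<close>)
  ultimately show ?thesis by simp
qed

lemma mono_on_flat_iff:
  assumes "C \<in> compositions G"
  shows "(\<forall>e\<in>flat_of G C. mono_on_set f (ends G e)) \<longleftrightarrow> (\<forall>P\<in>C. mono_on_set f P)"
proof
  assume *: "\<forall>e\<in>flat_of G C. mono_on_set f (ends G e)"
  show "\<forall>P\<in>C. mono_on_set f P"
  proof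
    fix P assume "P \<in> C"
    then show "mono_on_set f P"
      using assms * by (intro mono_on_connected[of G P]) (auto simp: compositions_def flat_of_def)
  qed
qed (auto simp: flat_of_def dest: mono_on_set_subset)

text \<open>The indicator function of \<open>P'\<close> is constant on the parts of \<open>C'\<close>, hence on the edges of the common
  flat, hence on \<open>P\<close>.\<close>

lemma flat_of_eq_imp_subset:
  assumes "C \<in> compositions G" "C' \<in> compositions G" "flat_of G C = flat_of G C'"
    and "P \<in> C" "P' \<in> C'" "x \<in> P" "x \<in> P'"
  shows "P \<subseteq> P'"
proof -
  have part: "partition_on (verts G) C'" using assms(2) by (simp add: compositions_def)
  have "\<forall>R\<in>C'. mono_on_set (\<lambda>v. v \<in> P') R"
  proof
    fix R assume R: "R \<in> C'"
    then have "R = P' \<or> R \<inter> P' = {}" using partition_unique_part[OF part R assms(5)] by blast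
    then show "mono_on_set (\<lambda>v. v \<in> P') R" by (auto simp: mono_on_set_def)
  qed
  then have "\<forall>e\<in>flat_of G C. mono_on_set (\<lambda>v. v \<in> P') (ends G e)"
    unfolding assms(3) mono_on_flat_iff[OF assms(2)] .
  then have "\<forall>R\<in>C. mono_on_set (\<lambda>v. v \<in> P') R"
    unfolding mono_on_flat_iff[OF assms(1)] .
  then have "mono_on_set (\<lambda>v. v \<in> P') P" using assms(4) by (rule bspec)
  then show ?thesis using assms(6,7) unfolding mono_on_set_def by blast
qed

lemma inj_on_flat_of: "inj_on (flat_of G) (compositions G)"
proof (rule inj_onI)
  have sub: "C \<subseteq> C'" if C: "C \<in> compositions G" "C' \<in> compositions G" "flat_of G C = flat_of G C'" for C C'
  proof
    fix P assume P: "P \<in> C"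
    have part: "partition_on (verts G) C" "partition_on (verts G) C'"
      using C by (simp_all add: compositions_def)
    obtain x where x: "x \<in> P" using part P by (metis partition_on_def ex_in_conv)
    then obtain P' where P': "P' \<in> C'" "x \<in> P'" using part P by (auto simp: partition_on_def)
    have "P \<subseteq> P'" by (rule flat_of_eq_imp_subset[OF C P P'(1) x P'(2)])
    moreover have "P' \<subseteq> P" by (rule flat_of_eq_imp_subset[OF C(2,1) C(3)[symmetric] P'(1) P P'(2) x])
    ultimately show "P \<in> C'" using P' by simp
  qed
  fix C C' assume "C \<in> compositions G" "C' \<in> compositions G" "flat_of G C = flat_of G C'"
  then show "C = C'" using sub by (metis subset_antisym)
qed

text \<open>The composition belonging to a colouring consists of the components of its monochromatic
  subgraph. Such a component is connected inside the original graph, because a walk of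
  monochromatic edges never leaves it.\<close>

lemma mono_edges_is_flat:
  assumes G: "loopless_graph G"
  shows "mono_edges G f \<in> flat_of G ` compositions G"
proof -
  define H where "H = \<lparr>verts = verts G, edges = mono_edges G f, ends = ends G\<rparr>"
  have H: "loopless_graph H" using G unfolding H_def loopless_graph_def mono_edges_def by auto
  have part: "partition_on (verts G) (components H)"
    using partition_on_components[of H] by (simp add: H_def)
  have conn: "connected_graph (induced_subgraph G P)" if P: "P \<in> components H" for P
  proof -
    let ?r = "(adjacency H)\<^sup>* \<inter> verts H \<times> verts H"
    let ?I = "induced_subgraph G P"
    have reach: "(x, y) \<in> (adjacency ?I)\<^sup>*" if x: "x \<in> P" and y: "y \<in> P" for x y
    proof -
      obtain x0 where x0: "P = ?r `` {x0}"
        using P unfolding components_def by (rule quotientE)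
      then have "(x0, x) \<in> ?r" using x by (simp only: Image_singleton_iff)
      then have Px: "P = ?r `` {x}"
        unfolding x0 by (rule equiv_class_eq[OF equiv_connectivity])
      then have "(x, y) \<in> (adjacency H)\<^sup>*" using y by auto
      then have "(x, y) \<in> (adjacency ?I)\<^sup>* \<and> y \<in> P"
      proof (induction rule: rtrancl_induct)
        case base
        then show ?case using x by simp
      next
        case (step y z)
        then obtain e where e: "e \<in> edges H" "ends H e = {y, z}" by (auto simp: adjacency_def)
        have "z \<in> verts H" using H e by (auto simp: loopless_graph_def)
        moreover have "(x, z) \<in> (adjacency H)\<^sup>*" using step by auto
        moreover have "x \<in> verts H" using Px x by auto
        ultimately have "z \<in> P" using Px by auto
        then have "(y, z) \<in> adjacency ?I"
          using e step by (auto simp: adjacency_def induced_subgraph_def H_def mono_edges_def)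
        then show ?case using step \<open>z \<in> P\<close> by auto
      qed
      then show ?thesis by simp
    qed
    have "P \<noteq> {}" using part P by (auto simp: partition_on_def)
    have "(adjacency ?I)\<^sup>* \<inter> P \<times> P = P \<times> P" using reach by auto
    then have "components ?I = P // (P \<times> P)" by (simp add: components_def induced_subgraph_def)
    also have "\<dots> = {P}" using \<open>P \<noteq> {}\<close> by (auto simp: quotient_def)
    finally show ?thesis by (simp add: connected_graph_def)
  qed
  have "flat_of G (components H) = mono_edges G f"
  proof
    have "mono_on_set f P" if "P \<in> components H" for P
      by (rule mono_on_component[OF _ that]) (simp add: H_def mono_edges_def)
    then show "flat_of G (components H) \<subseteq> mono_edges G f"
      by (auto simp: flat_of_def mono_edges_def dest: mono_on_set_subset)
    show "mono_edges G f \<subseteq> flat_of G (components H)"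
    proof
      fix e assume e: "e \<in> mono_edges G f"
      then have "e \<in> edges H" by (simp add: H_def)
      from edge_in_component[OF H this] obtain P where "P \<in> components H" "ends G e \<subseteq> P"
        by (auto simp: H_def)
      then show "e \<in> flat_of G (components H)"
        using e unfolding flat_of_def mono_edges_def by blast
    qed
  qed
  moreover have "components H \<in> compositions G"
    using part conn by (simp add: compositions_def)
  ultimately show ?thesis by (metis imageI)
qed

section \<open>Chromatic polynomials of contractions\<close>

text \<open>A colouring of the vertices of \<open>G/C\<close> is a colouring of \<open>G\<close> that is constant on the parts of \<open>C\<close>, that
  is, monochromatic on the flat; it is proper if no further edge is monochromatic.\<close>

lemma card_proper_colorings_contraction:
  assumes G: "loopless_graph G" and C: "C \<in> compositions G"
  shows "card (proper_colorings (contraction G C) k) =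
    card {f \<in> verts G \<rightarrow>\<^sub>E {..<k}. mono_edges G f = flat_of G C}"
proof -
  have part: "partition_on (verts G) C" using C by (simp add: compositions_def)
  define \<Phi> :: "('a set \<Rightarrow> nat) \<Rightarrow> 'a \<Rightarrow> nat"
    where "\<Phi> = (\<lambda>g. \<lambda>v\<in>verts G. g (THE P. P \<in> C \<and> v \<in> P))"
  have bij: "bij_betw \<Phi> (C \<rightarrow>\<^sub>E {..<k}) {f \<in> verts G \<rightarrow>\<^sub>E {..<k}. \<forall>P\<in>C. mono_on_set f P}"
    and val: "\<And>P v g. P \<in> C \<Longrightarrow> v \<in> P \<Longrightarrow> \<Phi> g v = g P"
    unfolding \<Phi>_def using bij_betw_colorings_parts[OF part] by blast+
  have iff: "mono_edges G (\<Phi> g) = flat_of G C \<longleftrightarrow> (\<forall>e\<in>edges G - flat_of G C.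
      \<forall>u v. {P \<in> C. P \<inter> ends G e \<noteq> {}} = {u, v} \<longrightarrow> g u \<noteq> g v)" for g
  proof -
    have "\<forall>P\<in>C. mono_on_set (\<Phi> g) P" by (auto simp: mono_on_set_def val)
    then have sub: "flat_of G C \<subseteq> mono_edges G (\<Phi> g)"
      using mono_on_flat_iff[OF C] by (auto simp: mono_edges_def flat_of_def)
    have "mono_on_set (\<Phi> g) (ends G e) \<longleftrightarrow>
        \<not> (\<forall>u v. {P \<in> C. P \<inter> ends G e \<noteq> {}} = {u, v} \<longrightarrow> g u \<noteq> g v)"
      if e: "e \<in> edges G - flat_of G C" for e
    proof -
      obtain a b where ab: "ends G e = {a, b}" "a \<in> verts G" "b \<in> verts G"
        using loopless_ends[OF G] e by (metis DiffD1)
      obtain P where P: "P \<in> C" "a \<in> P" using part ab by (auto simp: partition_on_def)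
      obtain P' where P': "P' \<in> C" "b \<in> P'" using part ab by (auto simp: partition_on_def)
      have "{R \<in> C. R \<inter> ends G e \<noteq> {}} = {P, P'}"
        using P P' partition_unique_part[OF part] unfolding ab by blast
      moreover have "mono_on_set (\<Phi> g) (ends G e) \<longleftrightarrow> g P = g P'"
        using val[OF P, of g] val[OF P', of g] unfolding ab by (auto simp: mono_on_set_def)
      moreover have "(\<forall>u v. {P, P'} = {u, v} \<longrightarrow> g u \<noteq> g v) \<longleftrightarrow> g P \<noteq> g P'"
        unfolding doubleton_eq_iff by metis
      ultimately show ?thesis by simp
    qed
    moreover have "mono_edges G (\<Phi> g) = flat_of G C \<longleftrightarrow>
        (\<forall>e\<in>edges G - flat_of G C. \<not> mono_on_set (\<Phi> g) (ends G e))"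
      using sub unfolding mono_edges_def by blast
    ultimately show ?thesis by simp
  qed
  have eq: "{f \<in> {f \<in> verts G \<rightarrow>\<^sub>E {..<k}. \<forall>P\<in>C. mono_on_set f P}. mono_edges G f = flat_of G C}
      = {f \<in> verts G \<rightarrow>\<^sub>E {..<k}. mono_edges G f = flat_of G C}"
    using mono_on_flat_iff[OF C] by (auto simp: mono_edges_def)
  have "bij_betw \<Phi> {g \<in> C \<rightarrow>\<^sub>E {..<k}. \<forall>e\<in>edges G - flat_of G C.
      \<forall>u v. {P \<in> C. P \<inter> ends G e \<noteq> {}} = {u, v} \<longrightarrow> g u \<noteq> g v}
     {f \<in> verts G \<rightarrow>\<^sub>E {..<k}. mono_edges G f = flat_of G C}"
    unfolding eq[symmetric] by (rule bij_betw_Collect[OF bij]) (rule iff)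
  then show ?thesis
    by (auto simp: proper_colorings_def contraction_def dest: bij_betw_same_card)
qed

text \<open>Deletion and contraction on the level of colour counts: an edge of \<open>B\<close> is either ignored or forced
  to be monochromatic, and the difference of the two counts is the count with that edge properly
  coloured.\<close>

lemma colorings_poly_exists:
  assumes "finite V" "finite B" "finite A" "\<And>e. e \<in> A \<union> B \<Longrightarrow> endp e \<subseteq> V \<and> card (endp e) = 2"
  shows "\<exists>p. \<forall>k. poly p (int k) = int (card {f \<in> V \<rightarrow>\<^sub>E {..<k}.
    (\<forall>e\<in>A. mono_on_set f (endp e)) \<and> (\<forall>e\<in>B. \<not> mono_on_set f (endp e))})"
  using assms(2,3,4)
proof (induction B arbitrary: A rule: finite_induct)
  case empty
  define H where "H = \<lparr>verts = V, edges = A, ends = endp\<rparr>"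
  have "loopless_graph H" using assms(1) empty by (auto simp: H_def loopless_graph_def)
  then have "\<forall>k. poly (monom 1 (card (components H))) (int k) = int (card {f \<in> V \<rightarrow>\<^sub>E {..<k}.
    (\<forall>e\<in>A. mono_on_set f (endp e)) \<and> (\<forall>e\<in>{}. \<not> mono_on_set f (endp e))})"
    using card_colorings_components[of H] by (simp add: poly_monom H_def)
  then show ?case by blast
next
  case (insert e B)
  let ?N = "\<lambda>A B k. {f \<in> V \<rightarrow>\<^sub>E {..<k::nat}. (\<forall>e\<in>A. mono_on_set f (endp e)) \<and> (\<forall>e\<in>B. \<not> mono_on_set f (endp e))}"
  have fin: "finite (?N A B k)" for A B k
    using assms(1) by (simp add: finite_PiE)
  have "\<exists>p. \<forall>k. poly p (int k) = int (card (?N A B k))"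
    by (rule insert.IH) (use insert.prems in auto)
  then obtain p where p: "\<forall>k. poly p (int k) = int (card (?N A B k))" ..
  have "\<exists>p. \<forall>k. poly p (int k) = int (card (?N (insert e A) B k))"
    by (rule insert.IH) (use insert.prems in auto)
  then obtain p' where p': "\<forall>k. poly p' (int k) = int (card (?N (insert e A) B k))" ..
  have "poly (p - p') (int k) = int (card (?N A (insert e B) k))" for k
  proof -
    have "?N A B k = ?N (insert e A) B k \<union> ?N A (insert e B) k" by auto
    moreover have "?N (insert e A) B k \<inter> ?N A (insert e B) k = {}" by auto
    ultimately have "card (?N A B k) = card (?N (insert e A) B k) + card (?N A (insert e B) k)"
      by (simp only: card_Un_disjoint[OF fin fin])
    then have "int (card (?N A B k)) = int (card (?N (insert e A) B k)) + int (card (?N A (insert e B) k))"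
      by (simp only: of_nat_add)
    then show ?thesis unfolding poly_diff p[rule_format] p'[rule_format] by linarith
  qed
  then show ?case by (intro exI[of _ "p - p'"] allI)
qed

lemma int_poly_eqI:
  assumes "\<And>k::nat. poly p (int k) = poly q (int k)"
  shows "p = q"
proof (rule ccontr)
  assume "p \<noteq> q"
  then have "finite {x. poly (p - q) x = 0}" by (intro poly_roots_finite) simp
  moreover have "range int \<subseteq> {x. poly (p - q) x = 0}" using assms by auto
  moreover have "infinite (range int)" by (simp add: finite_image_iff)
  ultimately show False using finite_subset by blast
qed

lemma poly_chromatic_poly_contraction:
  assumes G: "loopless_graph G" and C: "C \<in> compositions G"
  shows "poly (chromatic_poly (contraction G C)) (int k) =
    int (card {f \<in> verts G \<rightarrow>\<^sub>E {..<k}. mono_edges G f = flat_of G C})"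
proof -
  let ?A = "flat_of G C" and ?B = "edges G - flat_of G C"
  have eq: "{f \<in> verts G \<rightarrow>\<^sub>E {..<k}. mono_edges G f = flat_of G C} = {f \<in> verts G \<rightarrow>\<^sub>E {..<k}.
    (\<forall>e\<in>?A. mono_on_set f (ends G e)) \<and> (\<forall>e\<in>?B. \<not> mono_on_set f (ends G e))}" for k :: nat
    by (auto simp: mono_edges_def flat_of_def)
  have sub: "?A \<subseteq> edges G" by (auto simp: flat_of_def)
  have "\<exists>p. \<forall>k. poly p (int k) = int (card {f \<in> verts G \<rightarrow>\<^sub>E {..<k}.
    (\<forall>e\<in>?A. mono_on_set f (ends G e)) \<and> (\<forall>e\<in>?B. \<not> mono_on_set f (ends G e))})"
    using G sub by (intro colorings_poly_exists) (auto simp: loopless_graph_def intro: finite_subset)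
  then obtain p where p: "\<forall>k. poly p (int k) = int (card (proper_colorings (contraction G C) k))"
    unfolding eq[symmetric] card_proper_colorings_contraction[OF G C, symmetric] by blast
  have "chromatic_poly (contraction G C) = p"
    unfolding chromatic_poly_def using p by (intro the_equality) (auto intro: int_poly_eqI)
  then show ?thesis using p card_proper_colorings_contraction[OF G C] by simp
qed

section \<open>Ranks by counting colourings\<close>

text \<open>Enlarging the vertex set only multiplies colour sums by a power of the number of colours. This
  makes it harmless that restrictions drop their isolated vertices.\<close>

lemma sum_colorings_extend:
  fixes h :: "('v \<Rightarrow> 'c) \<Rightarrow> 'a::comm_semiring_1"
  assumes "finite V'" "V \<subseteq> V'" "finite S"
  shows "(\<Sum>f\<in>V' \<rightarrow>\<^sub>E S. h (restrict f V)) = of_nat (card S ^ card (V' - V)) * (\<Sum>f\<in>V \<rightarrow>\<^sub>E S. h f)"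
proof -
  have "(\<Sum>f\<in>V' \<rightarrow>\<^sub>E S. h (restrict f V)) = (\<Sum>(a, b)\<in>(V \<rightarrow>\<^sub>E S) \<times> (V' - V \<rightarrow>\<^sub>E S). h a)"
  proof (rule sum.reindex_bij_witness[where i="\<lambda>(a, b) v. if v \<in> V then a v else b v"
        and j="\<lambda>f. (restrict f V, restrict f (V' - V))"])
    fix f assume f: "f \<in> V' \<rightarrow>\<^sub>E S"
    show "(case (restrict f V, restrict f (V' - V)) of (a, b) \<Rightarrow> \<lambda>v. if v \<in> V then a v else b v) = f"
      using f by (auto simp: fun_eq_iff PiE_def extensional_def)
    show "(restrict f V, restrict f (V' - V)) \<in> (V \<rightarrow>\<^sub>E S) \<times> (V' - V \<rightarrow>\<^sub>E S)"
      using f assms(2) by auto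
  next
    fix ab assume ab: "ab \<in> (V \<rightarrow>\<^sub>E S) \<times> (V' - V \<rightarrow>\<^sub>E S)"
    obtain a b where [simp]: "ab = (a, b)" by (cases ab)
    let ?f = "\<lambda>v. if v \<in> V then a v else b v"
    have "restrict ?f V = a" "restrict ?f (V' - V) = b"
      using ab by (auto simp: fun_eq_iff PiE_def extensional_def)
    then show "(\<lambda>f. (restrict f V, restrict f (V' - V))) (case ab of (a, b) \<Rightarrow> \<lambda>v. if v \<in> V then a v else b v) = ab"
      by simp
    have "?f \<in> V' \<rightarrow>\<^sub>E S"
      using ab assms(2) by (intro PiE_I) auto
    then show "(case ab of (a, b) \<Rightarrow> \<lambda>v. if v \<in> V then a v else b v) \<in> V' \<rightarrow>\<^sub>E S" by simp
  qed auto
  also have "\<dots> = (\<Sum>a\<in>V \<rightarrow>\<^sub>E S. \<Sum>b\<in>V' - V \<rightarrow>\<^sub>E S. h a)"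
    by (rule sum.cartesian_product[symmetric])
  also have "card (V' - V \<rightarrow>\<^sub>E S) = card S ^ card (V' - V)"
    using assms by (simp add: card_PiE)
  then have "(\<Sum>a\<in>V \<rightarrow>\<^sub>E S. \<Sum>b\<in>V' - V \<rightarrow>\<^sub>E S. h a) = of_nat (card S ^ card (V' - V)) * (\<Sum>f\<in>V \<rightarrow>\<^sub>E S. h f)"
    by (simp add: sum_distrib_left)
  finally show ?thesis .
qed

lemma card_components_le:
  assumes "loopless_graph G"
  shows "card (components G) \<le> card (verts G)"
proof -
  have fin: "finite (verts G)" using assms by (simp add: loopless_graph_def)
  have "(2::nat) ^ card (components G) \<le> card (verts G \<rightarrow>\<^sub>E {..<2::nat})"
    unfolding card_colorings_components[OF assms, symmetric]
    using fin by (intro card_mono) (auto simp: finite_PiE)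
  also have "\<dots> = 2 ^ card (verts G)" using fin by (simp add: card_PiE)
  finally show ?thesis by simp
qed

lemma card_colorings_rk:
  assumes G: "loopless_graph G" and V': "verts G \<subseteq> V'" "finite V'"
  shows "card {f \<in> V' \<rightarrow>\<^sub>E {..<k::nat}. \<forall>e\<in>edges G. mono_on_set f (ends G e)} = k ^ (card V' - rk G)"
proof -
  let ?h = "\<lambda>f. of_bool (\<forall>e\<in>edges G. mono_on_set f (ends G e)) :: nat"
  have fin: "finite (verts G)" using G by (simp add: loopless_graph_def)
  have h: "?h (restrict f (verts G)) = ?h f" for f :: "'a \<Rightarrow> nat"
  proof -
    have "mono_on_set (restrict f (verts G)) (ends G e) = mono_on_set f (ends G e)" if "e \<in> edges G" for e
    proof -
      have "ends G e \<subseteq> verts G" using G that by (simp add: loopless_graph_def)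
      then have "restrict f (verts G) v = f v" if "v \<in> ends G e" for v using that by auto
      then show ?thesis by (simp add: mono_on_set_def)
    qed
    then show ?thesis by auto
  qed
  have c: "(\<Sum>f\<in>X \<rightarrow>\<^sub>E {..<k}. ?h f) = card {f \<in> X \<rightarrow>\<^sub>E {..<k}. \<forall>e\<in>edges G. mono_on_set f (ends G e)}"
    if "finite X" for X
    using that by (subst sum_of_bool_eq) (auto simp: finite_PiE Int_def)
  have "card {f \<in> V' \<rightarrow>\<^sub>E {..<k}. \<forall>e\<in>edges G. mono_on_set f (ends G e)}
      = k ^ card (V' - verts G) * k ^ card (components G)"
    using sum_colorings_extend[OF V'(2,1), of "{..<k}" ?h] c[OF V'(2)] c[OF fin]
    unfolding h card_colorings_components[OF G] by simp
  also have "card (V' - verts G) = card V' - card (verts G)"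
    using V' fin by (simp add: card_Diff_subset)
  finally show ?thesis
    using card_components_le[OF G] card_mono[OF V'(2,1)]
    by (simp add: rk_def power_add[symmetric])
qed

text \<open>Restrictions in terms of their edge sets; in this form iterated restrictions collapse.\<close>

definition edge_subgraph :: "('v, 'e) mgraph \<Rightarrow> 'e set \<Rightarrow> ('v, 'e) mgraph" where
  "edge_subgraph G A = \<lparr>verts = (\<Union>e\<in>A. ends G e), edges = A, ends = ends G\<rparr>"

lemma restriction_eq_edge_subgraph: "restriction G C = edge_subgraph G (flat_of G C)"
  by (simp add: restriction_def edge_subgraph_def)

lemma loopless_edge_subgraph:
  "loopless_graph G \<Longrightarrow> A \<subseteq> edges G \<Longrightarrow> loopless_graph (edge_subgraph G A)"
  unfolding loopless_graph_def edge_subgraph_def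
  by (auto intro: finite_subset)

lemma rk_restriction:
  assumes G: "loopless_graph G" and C: "C \<in> compositions G"
  shows "rk (restriction G C) + card C = card (verts G)"
proof -
  have fin: "finite (verts G)" using G by (simp add: loopless_graph_def)
  have part: "partition_on (verts G) C" using C by (simp add: compositions_def)
  have sub: "flat_of G C \<subseteq> edges G" by (auto simp: flat_of_def)
  let ?R = "edge_subgraph G (flat_of G C)"
  have R: "loopless_graph ?R" by (rule loopless_edge_subgraph[OF G sub])
  have vs: "verts ?R \<subseteq> verts G"
    using G sub by (auto simp: edge_subgraph_def loopless_graph_def)
  have "(2::nat) ^ (card (verts G) - rk ?R) = 2 ^ card C"
    using card_colorings_rk[OF R vs fin, of 2] card_colorings_parts[OF part fin, of 2]
    by (simp add: edge_subgraph_def mono_on_flat_iff[OF C])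
  then have "card (verts G) - rk ?R = card C" by simp
  moreover have "rk ?R \<le> card (verts G)"
    using card_mono[OF fin vs] by (simp add: rk_def)
  ultimately show ?thesis by (simp add: restriction_eq_edge_subgraph)
qed

section \<open>The defining equation as a sum over colourings\<close>

text \<open>Functions that agree with a Laurent polynomial away from \<open>0\<close>.\<close>

definition laurent :: "(real \<Rightarrow> real) \<Rightarrow> bool" where
  "laurent f \<longleftrightarrow> (\<exists>N p. \<forall>t. t \<noteq> 0 \<longrightarrow> t ^ N * f t = poly p t)"

lemma laurent_poly: "laurent (poly p)"
  unfolding laurent_def by (intro exI[of _ 0] exI[of _ p]) simp

lemma laurent_const: "laurent (\<lambda>t. c)"
  unfolding laurent_def by (intro exI[of _ 0] exI[of _ "[:c:]"]) simp

lemma laurent_id: "laurent (\<lambda>t. t)"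
  unfolding laurent_def by (intro exI[of _ 0] exI[of _ "[:0, 1:]"]) simp

lemma laurent_uminus: "laurent uminus"
  unfolding laurent_def by (intro exI[of _ 0] exI[of _ "[:0, -1:]"]) simp

lemma laurent_inverse: "laurent inverse"
  unfolding laurent_def by (intro exI[of _ 1] exI[of _ 1]) simp

lemma laurent_add: "laurent f \<Longrightarrow> laurent g \<Longrightarrow> laurent (\<lambda>t. f t + g t)"
proof -
  assume "laurent f" "laurent g"
  then obtain M p N q where "\<forall>t. t \<noteq> 0 \<longrightarrow> t ^ M * f t = poly p t" "\<forall>t. t \<noteq> 0 \<longrightarrow> t ^ N * g t = poly q t"
    unfolding laurent_def by blast
  then have "\<forall>t. t \<noteq> 0 \<longrightarrow> t ^ (M + N) * (f t + g t) = poly (monom 1 N * p + monom 1 M * q) t"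
    by (auto simp: power_add algebra_simps poly_monom)
  then show ?thesis unfolding laurent_def by blast
qed

lemma laurent_mult: "laurent f \<Longrightarrow> laurent g \<Longrightarrow> laurent (\<lambda>t. f t * g t)"
proof -
  assume "laurent f" "laurent g"
  then obtain M p N q where "\<forall>t. t \<noteq> 0 \<longrightarrow> t ^ M * f t = poly p t" "\<forall>t. t \<noteq> 0 \<longrightarrow> t ^ N * g t = poly q t"
    unfolding laurent_def by blast
  then have "\<forall>t. t \<noteq> 0 \<longrightarrow> t ^ (M + N) * (f t * g t) = poly (p * q) t"
    by (auto simp: power_add mult_ac)
  then show ?thesis unfolding laurent_def by blast
qed

lemma laurent_power: "laurent f \<Longrightarrow> laurent (\<lambda>t. f t ^ n)"
  by (induction n) (auto intro: laurent_const laurent_mult)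

lemma laurent_sum: "(\<And>i. i \<in> I \<Longrightarrow> laurent (f i)) \<Longrightarrow> laurent (\<lambda>t. \<Sum>i\<in>I. f i t)"
  by (induction I rule: infinite_finite_induct) (auto intro: laurent_const laurent_add)

lemma laurent_poly_inverse: "laurent (\<lambda>t. poly p (inverse t))"
proof (induction p)
  case 0
  then show ?case by (simp add: laurent_const)
next
  case (pCons a p)
  then show ?case by (simp add: laurent_add laurent_const laurent_mult laurent_inverse)
qed

lemma laurent_eqI:
  assumes "laurent f" "laurent g" "infinite {t. t \<noteq> 0 \<and> f t = g t}" "t \<noteq> 0"
  shows "f t = g t"
proof -
  obtain M p N q where p: "\<And>t. t \<noteq> 0 \<Longrightarrow> t ^ M * f t = poly p t"
    and q: "\<And>t. t \<noteq> 0 \<Longrightarrow> t ^ N * g t = poly q t"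
    using assms(1,2) unfolding laurent_def by blast
  define d where "d = monom 1 N * p - monom 1 M * q"
  have d: "poly d t = t ^ (M + N) * (f t - g t)" if "t \<noteq> 0" for t
    unfolding d_def poly_diff poly_mult poly_monom p[OF that, symmetric] q[OF that, symmetric]
    by (simp add: power_add algebra_simps)
  have "d = 0"
  proof (rule ccontr)
    assume "d \<noteq> 0"
    then have "finite {t. poly d t = 0}" by (rule poly_roots_finite)
    moreover have "{t. t \<noteq> 0 \<and> f t = g t} \<subseteq> {t. poly d t = 0}" using d by auto
    ultimately show False using assms(3) finite_subset by blast
  qed
  then show ?thesis using d[OF assms(4)] assms(4) by simp
qed

lemma eval_real_of_int: "eval_real p (real_of_int x) = real_of_int (poly p x)"
  by (induction p) auto

lemma finite_compositions: "loopless_graph G \<Longrightarrow> finite (compositions G)"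
proof -
  assume "loopless_graph G"
  then have "finite (Pow (Pow (verts G)))" by (simp add: loopless_graph_def)
  moreover have "compositions G \<subseteq> Pow (Pow (verts G))"
    by (auto simp: compositions_def partition_on_def)
  ultimately show ?thesis by (rule finite_subset[rotated])
qed

text \<open>Every colouring has exactly one composition whose flat is its set of monochromatic edges.\<close>

lemma sum_over_colorings:
  fixes h :: "'e set \<Rightarrow> 'a::comm_semiring_1"
  assumes G: "loopless_graph (G :: ('v, 'e) mgraph)"
  shows "(\<Sum>f\<in>verts G \<rightarrow>\<^sub>E {..<k::nat}. h (mono_edges G f)) =
    (\<Sum>C\<in>compositions G. of_nat (card {f \<in> verts G \<rightarrow>\<^sub>E {..<k}. mono_edges G f = flat_of G C})
        * h (flat_of G C))"
proof -
  have fin: "finite (verts G \<rightarrow>\<^sub>E {..<k})" using G by (simp add: loopless_graph_def finite_PiE)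
  have "(\<Sum>f\<in>verts G \<rightarrow>\<^sub>E {..<k}. h (mono_edges G f)) =
     (\<Sum>A\<in>flat_of G ` compositions G. \<Sum>f\<in>{f \<in> verts G \<rightarrow>\<^sub>E {..<k}. mono_edges G f = A}. h (mono_edges G f))"
    using mono_edges_is_flat[OF G] finite_compositions[OF G]
    by (intro sum.group[symmetric] fin) auto
  also have "\<dots> = (\<Sum>C\<in>compositions G. \<Sum>f\<in>{f \<in> verts G \<rightarrow>\<^sub>E {..<k}. mono_edges G f = flat_of G C}.
       h (mono_edges G f))"
    by (simp add: sum.reindex[OF inj_on_flat_of])
  finally show ?thesis by simp
qed

text \<open>The reformulation on which the computation rests. At \<open>t = 1/k\<close> the chromatic polynomials become
  colour counts, and the powers of \<open>k\<close> combine because \<open>rk(G[C]) = |V| - |C|\<close>.\<close>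

lemma inverse_KL_conditions_by_coloring:
  assumes G: "loopless_graph (G :: ('v, 'e) mgraph)"
    and rk0: "rk G = 0 \<Longrightarrow> Q G = 1"
    and deg: "rk G > 0 \<Longrightarrow> 2 * degree (Q G) < rk G"
    and count: "\<And>k::nat. k > 0 \<Longrightarrow> (- 1) ^ rk G * real k ^ (card (verts G) - rk G) * eval_real (Q G) (real k) =
      (\<Sum>f\<in>verts G \<rightarrow>\<^sub>E {..<k}. (- real k) ^ rk (edge_subgraph G (mono_edges G f)) *
         eval_real (Q (edge_subgraph G (mono_edges G f))) (inverse (real k)))"
  shows "inverse_KL_conditions Q G"
proof -
  define L where "L = (\<lambda>t::real. (- t) ^ rk G * eval_real (Q G) (inverse t))"
  define R where "R = (\<lambda>t::real. \<Sum>C\<in>compositions G.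
      (- 1) ^ rk (restriction G C) * eval_real (Q (restriction G C)) t *
              (t ^ card C * eval_real (chromatic_poly (contraction G C)) (inverse t)))"
  have lau: "laurent L" "laurent R"
    unfolding L_def R_def
    by (intro laurent_sum laurent_mult laurent_const laurent_power laurent_poly_inverse laurent_poly
        laurent_id laurent_uminus)+
  have rk_le: "rk G \<le> card (verts G)" by (simp add: rk_def)
  have eq: "L (inverse (real k)) = R (inverse (real k))" if k: "k > 0" for k :: nat
  proof -
    define n where "n = card (verts G)"
    have "real k ^ n * L (inverse (real k)) = (- 1) ^ rk G * real k ^ (n - rk G) * eval_real (Q G) (real k)"
    proof -
      have "real k ^ n = real k ^ (n - rk G) * real k ^ rk G"
        using rk_le by (simp add: n_def flip: power_add)
      moreover have "real k ^ rk G * (- inverse (real k)) ^ rk G = (- 1) ^ rk G"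
        using k by (simp flip: power_mult_distrib)
      ultimately show ?thesis by (simp add: L_def mult_ac)
    qed
    also have "\<dots> = (\<Sum>C\<in>compositions G. of_nat (card {f \<in> verts G \<rightarrow>\<^sub>E {..<k}. mono_edges G f = flat_of G C})
        * ((- real k) ^ rk (restriction G C) * eval_real (Q (restriction G C)) (inverse (real k))))"
      unfolding n_def count[OF k] restriction_eq_edge_subgraph
      by (rule sum_over_colorings[OF G])
    also have "\<dots> = (\<Sum>C\<in>compositions G. real k ^ n * ((- 1) ^ rk (restriction G C) *
        eval_real (Q (restriction G C)) (inverse (real k)) *
        (inverse (real k) ^ card C * eval_real (chromatic_poly (contraction G C)) (real k))))"
    proof (rule sum.cong[OF refl])
      fix C assume C: "C \<in> compositions G"
      have "eval_real (chromatic_poly (contraction G C)) (real k)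
          = real (card {f \<in> verts G \<rightarrow>\<^sub>E {..<k}. mono_edges G f = flat_of G C})"
        using eval_real_of_int[of _ "int k"] poly_chromatic_poly_contraction[OF G C, of k] by simp
      moreover have "(- real k) ^ rk (restriction G C)
          = (- 1) ^ rk (restriction G C) * (real k ^ n * inverse (real k) ^ card C)"
      proof -
        have "real k ^ n = real k ^ rk (restriction G C) * real k ^ card C"
          using rk_restriction[OF G C] by (simp add: n_def flip: power_add)
        moreover have "real k ^ card C * inverse (real k) ^ card C = 1"
          using k by (simp flip: power_mult_distrib)
        ultimately have "real k ^ n * inverse (real k) ^ card C = real k ^ rk (restriction G C)"
          by (simp add: mult.assoc)
        then show ?thesis by (simp add: power_minus[of "real k"])
      qed
      ultimately show "of_nat (card {f \<in> verts G \<rightarrow>\<^sub>E {..<k}. mono_edges G f = flat_of G C})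
        * ((- real k) ^ rk (restriction G C) * eval_real (Q (restriction G C)) (inverse (real k))) =
        real k ^ n * ((- 1) ^ rk (restriction G C) *
        eval_real (Q (restriction G C)) (inverse (real k)) *
        (inverse (real k) ^ card C * eval_real (chromatic_poly (contraction G C)) (real k)))"
        by (simp only: mult_ac)
    qed
    also have "\<dots> = real k ^ n * R (inverse (real k))"
      by (simp add: R_def sum_distrib_left)
    finally show ?thesis using k by simp
  qed
  (* The points 1/k are enough to identify two Laurent polynomials. *)
  have inf: "infinite {t. t \<noteq> 0 \<and> L t = R t}"
  proof -
    have "inj (\<lambda>k. inverse (real (Suc k)))" by (rule injI) simp
    then have "infinite (range (\<lambda>k. inverse (real (Suc k))))" using finite_imageD by blast
    moreover have "range (\<lambda>k. inverse (real (Suc k))) \<subseteq> {t. t \<noteq> 0 \<and> L t = R t}"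
      using eq[of "Suc _"] by (auto simp del: of_nat_Suc)
    ultimately show ?thesis using finite_subset by blast
  qed
  show ?thesis unfolding inverse_KL_conditions_def
  proof (intro conjI impI allI)
    assume "rk G > 0"
    then show "real (degree (Q G)) < real (rk G) / 2" using deg by simp
  next
    fix t :: real assume "t \<noteq> 0"
    then show "(- t) ^ rk G * eval_real (Q G) (inverse t) = (\<Sum>C\<in>compositions G.
      (- 1) ^ rk (restriction G C) * eval_real (Q (restriction G C)) t *
              (t ^ card C * eval_real (chromatic_poly (contraction G C)) (inverse t)))"
      using laurent_eqI[OF lau inf] by (simp add: L_def R_def)
  qed (rule rk0)
qed

section \<open>Uniqueness\<close>

text \<open>The contraction by all edges has no edges left.\<close>

lemma chromatic_poly_full_contraction:
  assumes G: "loopless_graph G" and C: "C \<in> compositions G" and full: "flat_of G C = edges G"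
  shows "chromatic_poly (contraction G C) = monom 1 (card C)"
proof (rule int_poly_eqI)
  fix k :: nat
  have part: "partition_on (verts G) C" using C by (simp add: compositions_def)
  have fin: "finite (verts G)" using G by (simp add: loopless_graph_def)
  have "{f \<in> verts G \<rightarrow>\<^sub>E {..<k}. mono_edges G f = flat_of G C} =
      {f \<in> verts G \<rightarrow>\<^sub>E {..<k}. \<forall>P\<in>C. mono_on_set f P}"
    unfolding mono_on_flat_iff[OF C, symmetric] full by (auto simp: mono_edges_def)
  then show "poly (chromatic_poly (contraction G C)) (int k) = poly (monom 1 (card C)) (int k)"
    unfolding poly_chromatic_poly_contraction[OF G C]
    using card_colorings_parts[OF part fin, of k] by (simp add: poly_monom)
qed

lemma poly_eq_nonzeroI:
  fixes p q :: "real poly"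
  assumes "\<And>t. t \<noteq> 0 \<Longrightarrow> poly p t = poly q t"
  shows "p = q"
proof (rule ccontr)
  assume "p \<noteq> q"
  then have "finite {x. poly (p - q) x = 0}" by (intro poly_roots_finite) simp
  moreover have "- {0} \<subseteq> {x. poly (p - q) x = 0}" using assms by auto
  moreover have "infinite (- {0::real})" by (simp add: Compl_eq_Diff_UNIV infinite_UNIV_char_0)
  ultimately show False using finite_subset by blast
qed

text \<open>The left-hand side is divisible by \<open>t\<^bsup>r - deg D\<^esup>\<close>, a power higher than \<open>deg D\<close>. So its coefficient
  at \<open>deg D\<close> vanishes, and either \<open>c = 0\<close> or the leading coefficient of \<open>D\<close> vanishes.\<close>

lemma low_degree_reversal_eq_0:
  fixes D :: "real poly"
  assumes deg: "2 * degree D < r" and eq: "\<And>t. t \<noteq> 0 \<Longrightarrow> t ^ r * poly D (inverse t) = c * poly D t"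
  shows "D = 0"
proof -
  let ?d = "degree D"
  have "monom 1 (r - ?d) * reflect_poly D = smult c D"
  proof (rule poly_eq_nonzeroI)
    fix t :: real assume t: "t \<noteq> 0"
    have "t ^ r = t ^ (r - ?d) * t ^ ?d" using deg by (simp flip: power_add)
    then show "poly (monom 1 (r - ?d) * reflect_poly D) t = poly (smult c D) t"
      using eq[OF t] t by (simp add: poly_monom poly_reflect_poly_nz)
  qed
  then have *: "coeff (monom 1 (r - ?d) * reflect_poly D) ?d = c * coeff D ?d"
    and **: "c = 0 \<Longrightarrow> monom 1 (r - ?d) * reflect_poly D = 0" by simp_all
  have "coeff (monom 1 (r - ?d) * reflect_poly D) ?d = 0"
    using deg by (simp add: coeff_monom_mult)
  then show ?thesis using * ** by auto
qed

text \<open>Induction on the number of edges. For a graph without isolated vertices, a restriction is either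
  the graph itself or has fewer edges. In the difference of the two defining equations only the
  terms of the first kind survive; their contractions have no edges, so each contributes the
  factor \<open>1\<close>, and their number is the constant \<open>c\<close> in
  \<open>low_degree_reversal_eq_0\<close>.\<close>

lemma inverse_KL_unique:
  fixes G :: "('v, 'e) mgraph"
  assumes A1: "\<And>H. H \<in> A1 \<Longrightarrow> loopless_graph H \<and> (\<forall>C\<in>compositions H. restriction H C \<in> A1) \<and>
      inverse_KL_conditions Q1 H"
    and A2: "\<And>H. H \<in> A2 \<Longrightarrow> loopless_graph H \<and> (\<forall>C\<in>compositions H. restriction H C \<in> A2) \<and>
      inverse_KL_conditions Q2 H"
    and "G \<in> A1" "G \<in> A2" "verts G = (\<Union>e\<in>edges G. ends G e)"
  shows "Q1 G = Q2 G"
  using assms(3-5)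
proof (induction "card (edges G)" arbitrary: G rule: less_induct)
  case less
  have G: "loopless_graph G" using A1 less by blast
  have K: "inverse_KL_conditions Q1 G" "inverse_KL_conditions Q2 G" using A1 A2 less by blast+
  show ?case
  proof (cases "rk G = 0")
    case True
    then show ?thesis using K by (simp add: inverse_KL_conditions_def)
  next
    case False
    (* The compositions whose restriction is G itself. *)
    let ?full = "{C \<in> compositions G. flat_of G C = edges G}"
    have full: "restriction G C = G" if "flat_of G C = edges G" for C
      using less(4) that by (simp add: restriction_def)
    have part: "Q1 (restriction G C) = Q2 (restriction G C)"
      if C: "C \<in> compositions G" "flat_of G C \<noteq> edges G" for C
    proof (rule less(1))
      have "flat_of G C \<subset> edges G" using C by (auto simp: flat_of_def)
      then show "card (edges (restriction G C)) < card (edges G)"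
        using G by (simp add: restriction_def loopless_graph_def psubset_card_mono)
    qed (use A1 A2 less C in \<open>auto simp: restriction_def\<close>)
    define D where "D = map_poly real_of_int (Q1 G - Q2 G)"
    have D: "poly D t = eval_real (Q1 G) t - eval_real (Q2 G) t" for t
      using eval_real_add[of "Q1 G - Q2 G" "Q2 G" t] by (simp add: D_def)
    have "D = 0"
    proof (rule low_degree_reversal_eq_0)
      have "degree (Q1 G - Q2 G) < real (rk G) / 2"
        using K False degree_diff_le_max[of "Q1 G" "Q2 G"]
        by (auto simp: inverse_KL_conditions_def max_def split: if_splits)
      moreover have "degree D \<le> degree (Q1 G - Q2 G)" unfolding D_def
        by (rule degree_le) (simp add: coeff_map_poly coeff_eq_0 del: coeff_diff)
      ultimately show "2 * degree D < rk G" by linarith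
      fix t :: real assume t: "t \<noteq> 0"
      let ?T = "\<lambda>Q C. (- 1) ^ rk (restriction G C) * eval_real (Q (restriction G C)) t *
              (t ^ card C * eval_real (chromatic_poly (contraction G C)) (inverse t))"
      have "(- t) ^ rk G * poly D (inverse t) = (\<Sum>C\<in>compositions G. ?T Q1 C - ?T Q2 C)"
        using K False t by (simp add: D inverse_KL_conditions_def right_diff_distrib sum_subtractf)
      also have "\<dots> = (\<Sum>C\<in>?full. ?T Q1 C - ?T Q2 C)"
        using part finite_compositions[OF G] by (intro sum.mono_neutral_right) auto
      also have "\<dots> = (\<Sum>C\<in>?full. (- 1) ^ rk G * poly D t)"
      proof (rule sum.cong[OF refl])
        fix C assume C: "C \<in> ?full"
        then have "t ^ card C * eval_real (chromatic_poly (contraction G C)) (inverse t) = 1"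
          using t by (simp add: chromatic_poly_full_contraction[OF G] eval_real_monom
              flip: power_mult_distrib)
        then show "?T Q1 C - ?T Q2 C = (- 1) ^ rk G * poly D t"
          using C by (simp add: full D right_diff_distrib)
      qed
      finally have "(- 1) ^ rk G * (t ^ rk G * poly D (inverse t)) = (- 1) ^ rk G * (card ?full * poly D t)"
        by (simp add: power_minus[of t])
      then show "t ^ rk G * poly D (inverse t) = card ?full * poly D t" by simp
    qed
    then show ?thesis
      unfolding D_def by (simp add: map_poly_eq_0_iff)
  qed
qed

section \<open>Words and blocks\<close>

text \<open>A subgraph of the fan is described by one pair of flags for each path vertex: whether it is joined
  to the hub, and whether it is joined to its left neighbour. A block is a maximal stretch of vertices
  joined by path edges. The function multiplies the weights \<open>\<phi> s r\<close> of the blocks, where \<open>s\<close> tells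
  whether the block is joined to the hub and \<open>r\<close> is its number of vertices; its second and third
  arguments describe the block that is currently being read. Starting with an empty block of weight
  \<open>1\<close> gives the product over all blocks.\<close>

fun block_prod :: "(bool \<Rightarrow> nat \<Rightarrow> 'a::comm_monoid_mult) \<Rightarrow> bool \<Rightarrow> nat \<Rightarrow> (bool \<times> bool) list \<Rightarrow> 'a" where
  "block_prod \<phi> s r [] = \<phi> s r"
| "block_prod \<phi> s r ((s', l) # xs) =
     (if l then block_prod \<phi> s (Suc r) xs else \<phi> s r * block_prod \<phi> s' 1 xs)"

text \<open>The flags of the monochromatic subgraph, if the hub has colour \<open>c0\<close>, the path vertices are coloured
  by the word, and \<open>c\<close> is the colour of the vertex to the left of the first one.\<close>

fun recolor :: "nat \<Rightarrow> nat \<Rightarrow> (bool \<times> bool) list \<Rightarrow> nat list \<Rightarrow> (bool \<times> bool) list" where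
  "recolor c0 c ((s, l) # xs) (w # ws) = (s \<and> w = c0, l \<and> w = c) # recolor c0 w xs ws"
| "recolor c0 c _ _ = []"

definition words :: "nat \<Rightarrow> nat \<Rightarrow> nat list set" where
  "words k n = {ws. set ws \<subseteq> {..<k} \<and> length ws = n}"

lemma words_0 [simp]: "words k 0 = {[]}"
  by (auto simp: words_def)

lemma sum_words_Suc: "(\<Sum>ws\<in>words k (Suc n). g ws) = (\<Sum>w<k. \<Sum>ws\<in>words k n. g (w # ws))"
proof -
  have "words k (Suc n) = (\<lambda>(w, ws). w # ws) ` ({..<k} \<times> words k n)"
    by (auto simp: words_def image_iff length_Suc_conv)
  moreover have "inj_on (\<lambda>(w, ws). w # ws) ({..<k} \<times> words k n)" by (auto simp: inj_on_def)
  ultimately show ?thesis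
    by (simp add: sum.reindex sum.cartesian_product case_prod_unfold)
qed

lemma sum_words_add:
  "(\<Sum>ws\<in>words k (m + n). g ws) = (\<Sum>u\<in>words k m. \<Sum>v\<in>words k n. g (u @ v))"
  by (induction m arbitrary: g) (simp_all add: sum_words_Suc)

text \<open>Flag lists of this form can be appended without merging blocks.\<close>

definition starts_block :: "(bool \<times> bool) list \<Rightarrow> bool" where
  "starts_block xs \<longleftrightarrow> (xs = [] \<or> \<not> snd (hd xs))"

text \<open>Vertices joined by a path edge are both joined to the hub or both not; \<open>s\<close> is the hub flag of the
  vertex to the left.\<close>

fun consistent :: "bool \<Rightarrow> (bool \<times> bool) list \<Rightarrow> bool" where
  "consistent s [] = True"
| "consistent s ((s', l) # xs) = ((l \<longrightarrow> s' = s) \<and> consistent s' xs)"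

lemma consistent_split:
  "consistent s xs \<Longrightarrow> \<exists>N ys s'. xs = replicate N (s, True) @ ys \<and> starts_block ys \<and> consistent s' ys"
proof (induction xs arbitrary: s)
  case Nil
  then show ?case by (auto simp: starts_block_def)
next
  case (Cons x xs)
  obtain s' l where x: "x = (s', l)" by (cases x)
  show ?case
  proof (cases l)
    case True
    then have "s' = s" "consistent s xs" using Cons.prems x by auto
    then obtain N ys t where "xs = replicate N (s, True) @ ys" "starts_block ys" "consistent t ys"
      using Cons.IH by blast
    then show ?thesis using x True \<open>s' = s\<close>
      by (intro exI[of _ "Suc N"] exI[of _ ys] exI[of _ t]) simp
  next
    case False
    then show ?thesis using x Cons.prems
      by (intro exI[of _ 0] exI[of _ "x # xs"] exI[of _ s]) (simp add: starts_block_def)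
  qed
qed

lemma block_prod_append:
  assumes "starts_block zs" "\<phi> True 0 = 1"
  shows "block_prod \<phi> s r (ys @ zs) = block_prod \<phi> s r ys * block_prod \<phi> True 0 zs"
proof (induction ys arbitrary: s r)
  case Nil
  then show ?case
  proof (cases zs)
    case (Cons z zs')
    then show ?thesis using assms by (cases z) (simp add: starts_block_def)
  qed (simp add: assms)
next
  case (Cons y ys)
  then show ?case by (cases y) (simp add: mult.assoc)
qed

lemma recolor_append:
  "length ys = length u \<Longrightarrow> recolor c0 c (ys @ zs) (u @ v) = recolor c0 c ys u @ recolor c0 (last (c # u)) zs v"
proof (induction ys u arbitrary: c rule: list_induct2)
  case (Cons x xs y ys)
  then show ?case by (cases x) simp
qed simp

lemma recolor_starts_block: "starts_block zs \<Longrightarrow> recolor c0 c zs v = recolor c0 c' zs v"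
  by (cases zs; cases v) (auto simp: starts_block_def)

lemma starts_block_recolor: "starts_block zs \<Longrightarrow> starts_block (recolor c0 c zs v)"
  by (cases zs; cases v) (auto simp: starts_block_def)

lemma block_prod_mult:
  "block_prod (\<lambda>s r. \<alpha> s r * \<beta> s r) s r xs = block_prod \<alpha> s r xs * block_prod \<beta> s r xs"
proof (induction xs arbitrary: s r)
  case (Cons x xs)
  then show ?case by (cases x) (simp add: mult_ac)
qed simp

lemma eval_real_block_prod:
  "eval_real (block_prod \<alpha> s r xs) x = block_prod (\<lambda>s r. eval_real (\<alpha> s r) x) s r xs"
proof (induction xs arbitrary: s r)
  case (Cons x xs)
  then show ?case by (cases x) (simp add: eval_real_mult)
qed simp

text \<open>A path vertex raises the rank if and only if it is joined to something on its left, the hub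
  included.\<close>

definition attached :: "(bool \<times> bool) list \<Rightarrow> nat" where
  "attached xs = length (filter (\<lambda>(s, l). s \<or> l) xs)"

lemma attached_simps [simp]:
  "attached [] = 0" "attached ((s, l) # xs) = (if s \<or> l then 1 else 0) + attached xs"
  by (simp_all add: attached_def)

lemma attached_le: "attached xs \<le> length xs"
  by (simp add: attached_def)

definition block_rk :: "bool \<Rightarrow> nat \<Rightarrow> nat" where
  "block_rk s r = (if s then r else r - 1)"

lemma block_prod_power_rk:
  "s \<or> r > 0 \<Longrightarrow> block_prod (\<lambda>s r. c ^ block_rk s r) s r xs = (c :: 'a::comm_semiring_1) ^ (block_rk s r + attached xs)"
proof (induction xs arbitrary: s r)
  case (Cons x xs)
  obtain s' l where x: "x = (s', l)" by (cases x)
  have "block_rk s (Suc r) = Suc (block_rk s r)" using Cons.prems by (auto simp: block_rk_def)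
  moreover have "block_rk s' 1 = (if s' then 1 else 0)" by (simp add: block_rk_def)
  ultimately show ?case
    using Cons.IH[of s "Suc r"] Cons.IH[of s' 1] by (auto simp: x power_add mult_ac)
qed simp

text \<open>Only the first vertex of a block away from the hub has a free colour.\<close>

lemma block_prod_free:
  "s \<or> r > 0 \<Longrightarrow> block_prod (\<lambda>s r. if s \<or> r = 0 then 1 else c) s r xs =
     (if s then 1 else c :: 'a::comm_semiring_1) * c ^ (length xs - attached xs)"
proof (induction xs arbitrary: s r)
  case (Cons x xs)
  obtain s' l where x: "x = (s', l)" by (cases x)
  have "Suc (length xs) - attached xs = Suc (length xs - attached xs)" using attached_le[of xs] by simp
  then show ?case
    using Cons.IH[of s "Suc r"] Cons.IH[of s' 1] Cons.prems by (auto simp: x)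
qed auto

section \<open>Colour sums over a single block\<close>

text \<open>The contribution \<open>(-k)\<^bsup>rk\<^esup> Q(1/k)\<close> of a single run: a fan if it has the hub colour (and is joined
  to the hub), a path otherwise. The exponent \<open>r - 1\<close> is truncated at \<open>r = 0\<close>, so that the empty run has
  weight \<open>1\<close>.\<close>

definition run_wt :: "nat \<Rightarrow> bool \<Rightarrow> nat \<Rightarrow> real" where
  "run_wt k s r = (if s then (- real k) ^ r * eval_real (fan_KL r) (inverse (real k)) else (- real k) ^ (r - 1))"

lemma run_wt_0 [simp]: "run_wt k s 0 = 1"
  by (simp add: run_wt_def fan_KL_def)

text \<open>The sum over the colourings of the \<open>N\<close> remaining vertices of a block, when the run that is being read
  has colour \<open>c\<close> and length \<open>r\<close> so far. The flag \<open>s\<close> tells whether the block is joined to the hub.\<close>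

definition tail_sum :: "nat \<Rightarrow> nat \<Rightarrow> bool \<Rightarrow> nat \<Rightarrow> nat \<Rightarrow> nat \<Rightarrow> real" where
  "tail_sum k c0 s c r N = (\<Sum>ws\<in>words k N.
     block_prod (run_wt k) (s \<and> c = c0) r (recolor c0 c (replicate N (s, True)) ws))"

lemma tail_sum_0 [simp]: "tail_sum k c0 s c r 0 = run_wt k (s \<and> c = c0) r"
  by (simp add: tail_sum_def)

lemma tail_sum_Suc:
  assumes "c < k"
  shows "tail_sum k c0 s c r (Suc N) = tail_sum k c0 s c (Suc r) N +
     run_wt k (s \<and> c = c0) r * (\<Sum>w\<in>{..<k} - {c}. tail_sum k c0 s w 1 N)"
proof -
  have "tail_sum k c0 s c r (Suc N) = (\<Sum>w<k. if w = c then tail_sum k c0 s c (Suc r) N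
      else run_wt k (s \<and> c = c0) r * tail_sum k c0 s w 1 N)"
    unfolding tail_sum_def sum_words_Suc by (intro sum.cong refl) (auto simp: sum_distrib_left)
  also have "\<dots> = tail_sum k c0 s c (Suc r) N +
      (\<Sum>w\<in>{..<k} - {c}. run_wt k (s \<and> c = c0) r * tail_sum k c0 s w 1 N)"
    using assms by (subst sum.remove[of _ c]) (auto intro!: sum.cong)
  finally show ?thesis by (simp add: sum_distrib_left)
qed

text \<open>Each further vertex contributes the factor \<open>-k + (k - 1) = -1\<close>: extending the run multiplies its
  weight by \<open>-k\<close>, and each of the \<open>k - 1\<close> other colours starts a new run of weight \<open>1\<close>.\<close>

lemma tail_sum_path:
  assumes "c < k" "r > 0"
  shows "tail_sum k c0 False c r N = (- real k) ^ (r - 1) * (- 1) ^ N"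
  using assms
proof (induction N arbitrary: c r)
  case 0
  then show ?case by (simp add: run_wt_def)
next
  case (Suc N)
  have "(\<Sum>w\<in>{..<k} - {c}. tail_sum k c0 False w 1 N) = (\<Sum>w\<in>{..<k} - {c}. (- 1) ^ N)"
    using Suc.IH[of _ 1] by (intro sum.cong) auto
  also have "\<dots> = (real k - 1) * (- 1) ^ N"
    using Suc.prems by (simp add: of_nat_diff)
  finally have *: "(\<Sum>w\<in>{..<k} - {c}. tail_sum k c0 False w 1 N) = (real k - 1) * (- 1) ^ N" .
  obtain r' where r: "r = Suc r'" using Suc.prems by (cases r) auto
  show ?case
    unfolding tail_sum_Suc[OF Suc.prems(1)] * using Suc.IH[of c "Suc r"] Suc.prems
    by (simp add: run_wt_def r algebra_simps)
qed

lemma path_block_sum: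
  "(\<Sum>w<k. tail_sum k c0 False w 1 N) = real k * (- 1) ^ N"
  using tail_sum_path[of _ k 1 c0 N] by simp

lemma geometric_fps: "Abs_fps (\<lambda>n. a ^ n) * (1 - fps_const a * fps_X) = (1 :: real fps)"
proof (rule fps_ext)
  fix n
  have *: "A * (1 - fps_const a * fps_X) = A - fps_X * (fps_const a * A)" for A :: "real fps"
    by (simp add: algebra_simps)
  show "(Abs_fps (\<lambda>n. a ^ n) * (1 - fps_const a * fps_X)) $ n = (1 :: real fps) $ n"
    unfolding * by (cases n) auto
qed

text \<open>The defining equation for fans. The runs of a word are decomposed from the left. With \<open>T\<close> the
  generating function of all words and \<open>x g\<^sub>c\<close> that of the words beginning with the letter \<open>c\<close>, splitting off the
  first run gives \<open>x g\<^sub>c = a\<^sub>c (T - x g\<^sub>c)\<close>, where \<open>a\<^sub>c\<close> is the generating function of the runs of colour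
  \<open>c\<close>: it is \<open>\<Phi>(1/k, -k x) - 1\<close> for the hub colour and \<open>x / (1 + k x)\<close> for the \<open>k - 1\<close> others.
  Together with \<open>T = 1 + (\<Sum>c. x g\<^sub>c)\<close> this expresses \<open>1/T\<close> through
  \<open>1/\<Phi>(1/k, -k x)\<close>, and the functional equation of the reciprocal series turns the result into
  \<open>1/\<Phi>(k, -x)\<close>.\<close>

lemma fan_block_sum:
  assumes c0: "c0 < k"
  shows "(\<Sum>w<k. tail_sum k c0 True w 1 N) = (- 1) ^ Suc N * eval_real (fan_KL (Suc N)) (real k)"
proof -
  define T where "T n = (case n of 0 \<Rightarrow> 1 | Suc m \<Rightarrow> \<Sum>w<k. tail_sum k c0 True w 1 m)" for n
  (* The total weight of the words of length n that do not begin with c; these are the words that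
     may follow a run of colour c. *)
  define A where "A c n = (case n of 0 \<Rightarrow> 1 | Suc m \<Rightarrow> T n - tail_sum k c0 True c 1 m)" for c n
  have A_Suc: "A c (Suc m) = (\<Sum>w\<in>{..<k} - {c}. tail_sum k c0 True w 1 m)" if "c < k" for c m
    using that by (simp add: A_def T_def sum.remove[of "{..<k}" c])
  (* The current run continues for j more letters; what follows begins with another letter. *)
  have conv: "tail_sum k c0 True c r m = (\<Sum>j\<le>m. run_wt k (c = c0) (r + j) * A c (m - j))"
    if c: "c < k" for c r m
  proof (induction m arbitrary: r)
    case 0
    then show ?case by (simp add: A_def)
  next
    case (Suc m)
    show ?case
      unfolding tail_sum_Suc[OF c] Suc.IH A_Suc[OF c, symmetric]
      by (subst sum.atMost_Suc_shift) simp
  qed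
  define Tf where "Tf = Abs_fps T"
  define g where "g c = Abs_fps (\<lambda>m. tail_sum k c0 True c 1 m)" for c
  define P where "P = Abs_fps (\<lambda>j. run_wt k True (Suc j))"
  define K where "K = fps_const (real k)"
  (* The numerator of 1 + a_c = (1 + (k+1) x) / (1 + k x) for a letter c other than the hub colour. *)
  define Y where "Y = 1 + (K + 1) * fps_X"
  have A_fps: "Abs_fps (A c) = Tf - fps_X * g c" for c
  proof (rule fps_ext)
    fix n show "Abs_fps (A c) $ n = (Tf - fps_X * g c) $ n"
      by (cases n) (simp_all add: A_def Tf_def T_def g_def)
  qed
  have g_conv: "g c = Abs_fps (\<lambda>j. run_wt k (c = c0) (Suc j)) * (Tf - fps_X * g c)" if "c < k" for c
    unfolding A_fps[symmetric]
    by (rule fps_ext) (simp add: g_def conv[OF that] fps_mult_nth atLeast0AtMost)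
  have g_other: "g c * Y = Tf" if c: "c < k" "c \<noteq> c0" for c
  proof -
    have geo: "Abs_fps (\<lambda>j. run_wt k (c = c0) (Suc j)) * (1 + K * fps_X) = 1"
      using geometric_fps[of "- real k"] c by (simp add: run_wt_def K_def fps_const_neg[symmetric] del: fps_const_neg)
    have "g c * (1 + K * fps_X) = Abs_fps (\<lambda>j. run_wt k (c = c0) (Suc j)) * (1 + K * fps_X) * (Tf - fps_X * g c)"
      by (subst g_conv[OF c(1)]) (simp only: mult_ac)
    then have "g c * (1 + K * fps_X) = Tf - fps_X * g c" unfolding geo by simp
    then have "g c * (1 + K * fps_X) + fps_X * g c = Tf" by (simp only: diff_add_cancel)
    then show ?thesis unfolding Y_def by (simp add: algebra_simps)
  qed
  have g_c0: "g c0 * (1 + fps_X * P) = P * Tf"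
  proof -
    have "g c0 = P * (Tf - fps_X * g c0)" using g_conv[OF c0] by (simp add: P_def)
    then have "g c0 + P * (fps_X * g c0) = P * Tf"
      by (simp only: right_diff_distrib eq_diff_eq)
    then show ?thesis by (simp add: algebra_simps)
  qed
  have T_fps: "Tf = 1 + fps_X * (\<Sum>c<k. g c)"
  proof (rule fps_ext)
    fix n show "Tf $ n = (1 + fps_X * (\<Sum>c<k. g c)) $ n"
      by (cases n) (simp_all add: Tf_def T_def g_def fps_sum_nth)
  qed
  have "(\<Sum>c<k. g c) * Y = g c0 * Y + (\<Sum>c\<in>{..<k} - {c0}. g c * Y)"
    using c0 by (simp add: sum.remove[of "{..<k}" c0] distrib_right sum_distrib_right)
  also have "(\<Sum>c\<in>{..<k} - {c0}. g c * Y) = (\<Sum>c\<in>{..<k} - {c0}. Tf)"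
    using g_other by (intro sum.cong) auto
  also have "\<dots> = (K - 1) * Tf"
  proof -
    have "K - 1 = of_nat (k - 1)" using c0 by (simp add: K_def fps_of_nat of_nat_diff)
    then show ?thesis using c0 by simp
  qed
  finally have sumY: "(\<Sum>c<k. g c) * Y = g c0 * Y + (K - 1) * Tf" .
  define \<Phi> where "\<Phi> = 1 + fps_X * P"
  define R where "R = 1 - Abs_fps (\<lambda>n. case n of 0 \<Rightarrow> 0 | Suc m \<Rightarrow> height_sum 1 (inverse (real k)) m * (- real k) ^ Suc m)"
  define R' where "R' = 1 - Abs_fps (\<lambda>n. case n of 0 \<Rightarrow> 0 | Suc m \<Rightarrow> height_sum 1 (real k) m * (- 1) ^ Suc m)"
  define \<Phi>' where "\<Phi>' = Abs_fps (\<lambda>n. eval_real (fan_KL n) (real k) * (- 1) ^ n)"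
  have \<Phi>: "\<Phi> = Abs_fps (\<lambda>n. eval_real (fan_KL n) (inverse (real k)) * (- real k) ^ n)"
  proof (rule fps_ext)
    fix n show "\<Phi> $ n = Abs_fps (\<lambda>n. eval_real (fan_KL n) (inverse (real k)) * (- real k) ^ n) $ n"
      by (cases n) (simp_all add: \<Phi>_def P_def run_wt_def fan_KL_def[of 0])
  qed
  have \<Phi>R: "\<Phi> * R = 1" unfolding \<Phi> R_def by (rule fan_KL_fps_inverse)
  have \<Phi>R': "\<Phi>' * R' = 1" unfolding \<Phi>'_def R'_def by (rule fan_KL_fps_inverse)
  (* R and R' are the reciprocals of the series at (1/k, -k x) and (k, -x); the functional
     equation evaluates their difference. *)
  have RR: "R - R' = (K - 1) * fps_X * Abs_fps (\<lambda>n. (- (1 + real k)) ^ n)"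
  proof -
    have "(height_sum 1 (real k) m * (- 1) ^ Suc m) - height_sum 1 (inverse (real k)) m * (- real k) ^ Suc m
      = (real k - 1) * (- (1 + real k)) ^ m" for m
    proof -
      have "(real k ^ Suc m * height_sum 1 (inverse (real k)) m - height_sum 1 (real k) m) * (- 1) ^ m
          = (real k - 1) * (1 + real k) ^ m * (- 1) ^ m"
        using height_sum_1_inverse[of "real k" m] c0 by simp
      then show ?thesis
        unfolding power_minus[of "real k"] power_minus[of "1 + real k"] by (simp add: algebra_simps)
    qed
    moreover have shift: "(K - 1) * fps_X * Z = fps_X * (fps_const (real k - 1) * Z)" for Z
      by (simp add: K_def fps_const_sub[symmetric] mult_ac del: fps_const_sub)
    ultimately show ?thesis
      unfolding shift by (intro fps_ext) (auto simp: R_def R'_def split: nat.splits)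
  qed
  have YRR: "Y * (R - R') = (K - 1) * fps_X"
  proof -
    have "Abs_fps (\<lambda>n. (- (1 + real k)) ^ n) * Y = 1"
    proof -
      have "Y = 1 - fps_const (- (1 + real k)) * fps_X"
        unfolding Y_def K_def fps_const_neg[symmetric] fps_const_add[symmetric]
        by (simp add: algebra_simps del: fps_const_neg fps_const_add)
      then show ?thesis using geometric_fps[of "- (1 + real k)"] by (simp only:)
    qed
    then show ?thesis unfolding RR by (simp add: mult_ac)
  qed
  have "Tf * (Y * \<Phi>) = (1 + fps_X * (\<Sum>c<k. g c)) * (Y * \<Phi>)" by (rule arg_cong[OF T_fps])
  also have "\<dots> = Y * \<Phi> + fps_X * ((\<Sum>c<k. g c) * Y) * \<Phi>"
    by (simp only: algebra_simps mult_1_left mult_1_right)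
  also have "\<dots> = Y * \<Phi> + fps_X * Y * (g c0 * \<Phi>) + (K - 1) * fps_X * Tf * \<Phi>"
    unfolding sumY by (simp only: algebra_simps)
  also have "g c0 * \<Phi> = P * Tf" unfolding \<Phi>_def by (rule g_c0)
  also have "Y * \<Phi> + fps_X * Y * (P * Tf) + (K - 1) * fps_X * Tf * \<Phi>
      = Y * \<Phi> + Tf * Y * (\<Phi> - 1) + (K - 1) * fps_X * Tf * \<Phi>"
    unfolding \<Phi>_def by (simp add: algebra_simps)
  finally have "Tf * Y = Y * \<Phi> + (K - 1) * fps_X * Tf * \<Phi>"
    by (simp add: algebra_simps)
  then have "Tf * Y * R = Y * (\<Phi> * R) + (K - 1) * fps_X * Tf * (\<Phi> * R)"
    by (simp only: distrib_right mult.assoc)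
  then have "Tf * Y * R = Y + Y * (R - R') * Tf" unfolding \<Phi>R YRR by simp
  then have "Y * (Tf * R') = Y" by (simp add: algebra_simps)
  moreover have "Y $ 0 = 1" by (simp add: Y_def)
  then have "Y \<noteq> 0" by auto
  ultimately have "Tf * R' = 1" by simp
  then have "Tf = \<Phi>'" using \<Phi>R' by (metis mult.assoc mult.commute mult_1_left)
  then have "Tf $ Suc N = \<Phi>' $ Suc N" by simp
  then show ?thesis by (simp add: Tf_def T_def \<Phi>'_def mult.commute)
qed

text \<open>The values of the colour sums over a single block, for a fixed hub colour.\<close>

definition fan_wt :: "nat \<Rightarrow> bool \<Rightarrow> nat \<Rightarrow> real" where
  "fan_wt k s N = (if N = 0 then 1 else if s then (- 1) ^ N * eval_real (fan_KL N) (real k)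
     else real k * (- 1) ^ (N - 1))"

text \<open>Both sides are multiplicative when the first block is split off, because no run extends across a
  missing path edge.\<close>

lemma sum_words_block_prod:
  assumes "c0 < k" "starts_block xs" "consistent s xs"
  shows "(\<Sum>ws\<in>words k (length xs). block_prod (run_wt k) True 0 (recolor c0 c xs ws)) =
    block_prod (fan_wt k) True 0 xs"
  using assms(2,3)
proof (induction "length xs" arbitrary: xs s c rule: less_induct)
  case less
  show ?case
  proof (cases xs)
    case Nil
    then show ?thesis by (simp add: fan_wt_def)
  next
    case (Cons x xs')
    then obtain t where x: "x = (t, False)" using less(2) by (cases x) (auto simp: starts_block_def)
    then have "consistent t xs'" using less(3) Cons by simp
    then obtain N ys s' where xs': "xs' = replicate N (t, True) @ ys" and ys: "starts_block ys" "consistent s' ys"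
      using consistent_split by blast
    let ?F = "\<lambda>u. block_prod (run_wt k) True 0 (recolor c0 c ((t, False) # replicate N (t, True)) u)"
    let ?L = "\<lambda>v. block_prod (run_wt k) True 0 (recolor c0 c ys v)"
    have len: "length xs = Suc N + length ys" by (simp add: Cons xs')
    have "(\<Sum>ws\<in>words k (length xs). block_prod (run_wt k) True 0 (recolor c0 c xs ws)) =
        (\<Sum>u\<in>words k (Suc N). \<Sum>v\<in>words k (length ys). ?F u * ?L v)"
      unfolding len sum_words_add
    proof (intro sum.cong refl)
      fix u v assume u: "u \<in> words k (Suc N)"
      let ?z = "(t, False) # replicate N (t, True)"
      have "recolor c0 c xs (u @ v) = recolor c0 c (?z @ ys) (u @ v)" by (simp add: Cons x xs')
      also have "\<dots> = recolor c0 c ?z u @ recolor c0 (last (c # u)) ys v"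
        using u by (intro recolor_append) (simp add: words_def)
      also have "recolor c0 (last (c # u)) ys v = recolor c0 c ys v"
        by (rule recolor_starts_block[OF ys(1)])
      finally show "block_prod (run_wt k) True 0 (recolor c0 c xs (u @ v)) = ?F u * ?L v"
        using block_prod_append[OF starts_block_recolor[OF ys(1)], of "run_wt k"] by simp
    qed
    also have "\<dots> = (\<Sum>u\<in>words k (Suc N). ?F u) * (\<Sum>v\<in>words k (length ys). ?L v)"
      by (simp add: sum_product)
    also have "(\<Sum>v\<in>words k (length ys). ?L v) = block_prod (fan_wt k) True 0 ys"
      using less(1)[of ys] len ys by simp
    also have "(\<Sum>u\<in>words k (Suc N). ?F u) = (\<Sum>w<k. tail_sum k c0 t w 1 N)"
      by (simp add: sum_words_Suc tail_sum_def)
    also have "\<dots> = fan_wt k t (Suc N)"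
      using path_block_sum[of k c0 N] fan_block_sum[OF assms(1), of N] by (cases t) (auto simp: fan_wt_def)
    also have "fan_wt k t (Suc N) * block_prod (fan_wt k) True 0 ys = block_prod (fan_wt k) True 0 xs"
    proof -
      have rep: "block_prod (fan_wt k) t r (replicate N (t, True)) = fan_wt k t (r + N)" for r
        by (induction N arbitrary: r) auto
      have "block_prod (fan_wt k) True 0 xs =
          block_prod (fan_wt k) True 0 ((t, False) # replicate N (t, True)) * block_prod (fan_wt k) True 0 ys"
        using block_prod_append[OF ys(1), of "fan_wt k" True 0 "(t, False) # replicate N (t, True)"]
        by (simp add: Cons x xs' fan_wt_def)
      then show ?thesis using rep[of 1] by (simp add: fan_wt_def)
    qed
    finally show ?thesis .
  qed
qed

section \<open>Subgraphs of the fan\<close>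

lemma mono_on_pair: "mono_on_set f {a, b} \<longleftrightarrow> f a = f b"
  by (auto simp: mono_on_set_def)

text \<open>Edge sets of disjoint blocks, each of which is a fan (glued at the hub) or a path. Flats of the fan
  satisfy the condition, and it is inherited by flats of such subgraphs. Two fan blocks whose
  neighbouring ends are not joined by their path edge are allowed, although they do not form a flat:
  the larger class is easier to describe.\<close>

definition admissible :: "nat \<Rightarrow> nat set set \<Rightarrow> bool" where
  "admissible n A \<longleftrightarrow> A \<subseteq> edges (fan n) \<and>
     (\<forall>i. 1 \<le> i \<and> i < n \<and> {i, Suc i} \<in> A \<longrightarrow> ({0, i} \<in> A \<longleftrightarrow> {0, Suc i} \<in> A))"

text \<open>For \<open>i = 1\<close> the left neighbour would be the hub, whose edge is already recorded in the first
  component; hence the condition \<open>2 \<le> i\<close>.\<close>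

definition flag :: "nat set set \<Rightarrow> nat \<Rightarrow> bool \<times> bool" where
  "flag A i = ({0, i} \<in> A, 2 \<le> i \<and> {i - 1, i} \<in> A)"

abbreviation flags :: "nat \<Rightarrow> nat set set \<Rightarrow> (bool \<times> bool) list" where
  "flags n A \<equiv> map (flag A) [1..<Suc n]"

definition block_KL :: "bool \<Rightarrow> nat \<Rightarrow> int poly" where
  "block_KL s r = (if s then fan_KL r else 1)"

definition fan_Q :: "nat \<Rightarrow> (nat, nat set) mgraph \<Rightarrow> int poly" where
  "fan_Q n H = block_prod block_KL True 0 (flags n (edges H))"

lemma fan_edgeE:
  assumes "e \<in> edges (fan n)"
  obtains i where "1 \<le> i" "i < n" "e = {i, Suc i}" | i where "1 \<le> i" "i \<le> n" "e = {0, i}"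
  using assms by (auto simp: fan_def)

lemma ends_fan [simp]: "ends (fan n) e = e"
  by (simp add: fan_def)

lemma verts_fan: "verts (fan n) = {0..n}"
  by (simp add: fan_def)

lemma loopless_fan: "loopless_graph (fan n)"
proof -
  have "edges (fan n) \<subseteq> Pow {0..n}" by (auto simp: fan_def)
  then have "finite (edges (fan n))" by (rule finite_subset) simp
  moreover have "e \<subseteq> {0..n} \<and> card e = 2" if "e \<in> edges (fan n)" for e
    using that by (rule fan_edgeE) auto
  ultimately show ?thesis by (simp add: loopless_graph_def verts_fan)
qed

lemma spoke_in_fan: "1 \<le> i \<Longrightarrow> i \<le> n \<Longrightarrow> {0, i} \<in> edges (fan n)"
  by (auto simp: fan_def)

lemma admissible_edges: "admissible n (edges (fan n))"
  using spoke_in_fan unfolding admissible_def by simp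

lemma fan_eq_edge_subgraph: "n \<ge> 1 \<Longrightarrow> edge_subgraph (fan n) (edges (fan n)) = fan n"
proof -
  assume n: "n \<ge> 1"
  have "\<Union> (edges (fan n)) = {0..n}"
  proof
    show "\<Union> (edges (fan n)) \<subseteq> {0..n}"
      using loopless_fan[of n] by (auto simp: loopless_graph_def verts_fan)
    show "{0..n} \<subseteq> \<Union> (edges (fan n))"
    proof
      fix v assume v: "v \<in> {0..n}"
      have "{0, max v 1} \<in> edges (fan n)" using v n by (auto simp: fan_def max_def)
      then show "v \<in> \<Union> (edges (fan n))" by (rule UnionI) (auto simp: max_def)
    qed
  qed
  then show ?thesis by (simp add: edge_subgraph_def fan_def)
qed

lemma consistent_flags:
  assumes "admissible n A" "m \<ge> 1" "m + d \<le> Suc n" "2 \<le> m \<Longrightarrow> s = ({0, m - 1} \<in> A)"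
  shows "consistent s (map (flag A) [m..<m + d])"
  using assms(2-)
proof (induction d arbitrary: m s)
  case (Suc d)
  have "consistent ({0, m} \<in> A) (map (flag A) [Suc m..<Suc m + d])"
    using Suc.prems by (intro Suc.IH) auto
  moreover have "({0, m} \<in> A) = s" if l: "2 \<le> m" "{m - 1, m} \<in> A"
  proof -
    obtain i where m: "m = Suc i" using l(1) by (cases m) auto
    have "1 \<le> i \<and> i < n \<and> {i, Suc i} \<in> A" using l Suc.prems m by simp
    then have "{0, i} \<in> A \<longleftrightarrow> {0, Suc i} \<in> A" using assms(1) unfolding admissible_def by blast
    then show ?thesis using Suc.prems(3)[OF l(1)] m by simp
  qed
  moreover have "flag A m = ({0, m} \<in> A, 2 \<le> m \<and> {m - 1, m} \<in> A)" by (simp add: flag_def)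
  ultimately show ?case by (simp add: upt_conv_Cons del: upt_Suc)
qed simp

lemma starts_block_flags: "starts_block (flags n A)"
  by (cases n) (simp_all add: starts_block_def upt_conv_Cons flag_def del: upt_Suc)

lemma recolor_flags:
  "m \<ge> 1 \<Longrightarrow> recolor (f 0) (f (m - 1)) (map (flag A) [m..<m + d]) (map f [m..<m + d]) =
     map (flag {e \<in> A. mono_on_set f e}) [m..<m + d]"
proof (induction d arbitrary: m)
  case (Suc d)
  have "flag {e \<in> A. mono_on_set f e} m =
      ({0, m} \<in> A \<and> f m = f 0, (2 \<le> m \<and> {m - 1, m} \<in> A) \<and> f m = f (m - 1))"
    by (auto simp: flag_def mono_on_pair)
  moreover have "flag A m = ({0, m} \<in> A, 2 \<le> m \<and> {m - 1, m} \<in> A)" by (simp add: flag_def)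
  ultimately show ?case using Suc.IH[of "Suc m"] by (simp add: upt_conv_Cons del: upt_Suc)
qed simp

lemma mono_edges_edge_subgraph:
  "mono_edges (edge_subgraph G A) f = {e \<in> A. mono_on_set f (ends G e)}"
  by (simp add: mono_edges_def edge_subgraph_def)

lemma edge_subgraph_edge_subgraph:
  "edge_subgraph (edge_subgraph G A) B = edge_subgraph G B"
  by (simp add: edge_subgraph_def)

lemma admissible_mono:
  assumes "admissible n A"
  shows "admissible n {e \<in> A. mono_on_set f e}"
  unfolding admissible_def
proof (intro conjI allI impI)
  show "{e \<in> A. mono_on_set f e} \<subseteq> edges (fan n)" using assms by (auto simp: admissible_def)
  fix i assume i: "1 \<le> i \<and> i < n \<and> {i, Suc i} \<in> {e \<in> A. mono_on_set f e}"
  then have "{0, i} \<in> A \<longleftrightarrow> {0, Suc i} \<in> A" using assms unfolding admissible_def by blast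
  moreover have "f i = f (Suc i)" using i by (simp add: mono_on_pair)
  ultimately show "{0, i} \<in> {e \<in> A. mono_on_set f e} \<longleftrightarrow> {0, Suc i} \<in> {e \<in> A. mono_on_set f e}"
    by (simp add: mono_on_pair)
qed

lemma sum_colorings_words:
  "(\<Sum>f\<in>{0..n} \<rightarrow>\<^sub>E {..<k}. g (map f [0..<Suc n])) = (\<Sum>ws\<in>words k (Suc n). g ws)"
proof (rule sum.reindex_bij_witness[where i="\<lambda>ws. \<lambda>i\<in>{0..n}. ws ! i" and j="\<lambda>f. map f [0..<Suc n]"])
  fix f assume f: "f \<in> {0..n} \<rightarrow>\<^sub>E {..<k}"
  show "(\<lambda>i\<in>{0..n}. map f [0..<Suc n] ! i) = f"
  proof
    fix i show "(\<lambda>i\<in>{0..n}. map f [0..<Suc n] ! i) i = f i"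
      using f by (cases "i \<le> n") (auto simp: PiE_def extensional_def simp del: upt_Suc)
  qed
  show "map f [0..<Suc n] \<in> words k (Suc n)"
    using f by (auto simp: words_def PiE_def Pi_def simp del: upt_Suc)
next
  fix ws assume ws: "ws \<in> words k (Suc n)"
  show "map (\<lambda>i\<in>{0..n}. ws ! i) [0..<Suc n] = ws"
    using ws by (intro nth_equalityI) (auto simp: words_def simp del: upt_Suc)
  show "(\<lambda>i\<in>{0..n}. ws ! i) \<in> {0..n} \<rightarrow>\<^sub>E {..<k}"
  proof (intro PiE_I)
    fix i assume i: "i \<in> {0..n}"
    then have "ws ! i \<in> set ws" using ws by (simp add: words_def)
    then have "ws ! i \<in> {..<k}" using ws unfolding words_def by blast
    then show "(\<lambda>i\<in>{0..n}. ws ! i) i \<in> {..<k}" using i by simp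
  qed simp
qed simp

lemma sum_fan_colorings:
  "(\<Sum>f\<in>{0..n} \<rightarrow>\<^sub>E {..<k}. g (flags n {e \<in> A. mono_on_set f e})) =
   (\<Sum>c0<k. \<Sum>ws\<in>words k (length (flags n A)). g (recolor c0 c0 (flags n A) ws))"
proof -
  have "(\<Sum>f\<in>{0..n} \<rightarrow>\<^sub>E {..<k}. g (flags n {e \<in> A. mono_on_set f e})) =
     (\<Sum>f\<in>{0..n} \<rightarrow>\<^sub>E {..<k}. (\<lambda>ws. g (recolor (hd ws) (hd ws) (flags n A) (tl ws))) (map f [0..<Suc n]))"
  proof (intro sum.cong refl)
    fix f :: "nat \<Rightarrow> nat"
    have "map f [0..<Suc n] = f 0 # map f [1..<Suc n]" by (simp add: upt_conv_Cons del: upt_Suc)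
    then show "g (flags n {e \<in> A. mono_on_set f e}) =
      (\<lambda>ws. g (recolor (hd ws) (hd ws) (flags n A) (tl ws))) (map f [0..<Suc n])"
      using recolor_flags[of 1 f A n] by (simp del: upt_Suc)
  qed
  also have "\<dots> = (\<Sum>ws\<in>words k (Suc n). g (recolor (hd ws) (hd ws) (flags n A) (tl ws)))"
    by (rule sum_colorings_words)
  finally show ?thesis by (simp add: sum_words_Suc del: upt_Suc)
qed

text \<open>Read from the left, a vertex that is joined to the hub or to its left neighbour has its colour
  forced, and any other vertex is free.\<close>

lemma count_fitting_words:
  "consistent s xs \<Longrightarrow> (s \<Longrightarrow> c = c0) \<Longrightarrow> c < k \<Longrightarrow> c0 < k \<Longrightarrow>
    (\<Sum>ws\<in>words k (length xs). of_bool (recolor c0 c xs ws = xs)) = k ^ (length xs - attached xs)"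
proof (induction xs arbitrary: s c)
  case (Cons x xs)
  obtain s' l where x: "x = (s', l)" by (cases x)
  let ?ok = "\<lambda>w. (s' \<longrightarrow> w = c0) \<and> (l \<longrightarrow> w = c)"
  have "(\<Sum>ws\<in>words k (length (x # xs)). of_bool (recolor c0 c (x # xs) ws = x # xs)) =
     (\<Sum>w<k. if ?ok w then k ^ (length xs - attached xs) else 0)"
    unfolding length_Cons sum_words_Suc
  proof (intro sum.cong refl)
    fix w assume w: "w \<in> {..<k}"
    have "(\<Sum>ws\<in>words k (length xs). of_bool (recolor c0 w xs ws = xs)) = k ^ (length xs - attached xs)"
      if "?ok w"
      using that Cons.prems x w by (intro Cons.IH[of s']) auto
    then show "(\<Sum>ws\<in>words k (length xs). of_bool (recolor c0 c (x # xs) (w # ws) = x # xs)) =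
       (if ?ok w then k ^ (length xs - attached xs) else 0)"
      by (auto simp: x)
  qed
  also have "\<dots> = card {w \<in> {..<k}. ?ok w} * k ^ (length xs - attached xs)"
    by (simp add: sum.If_cases Int_def)
  also have "card {w \<in> {..<k}. ?ok w} = (if s' \<or> l then 1 else k)"
  proof (cases "s' \<or> l")
    case True
    have "{w \<in> {..<k}. ?ok w} = {if s' then c0 else c}" using True Cons.prems x by auto
    then show ?thesis using True by simp
  qed simp
  finally show ?case using attached_le[of xs] by (simp add: x Suc_diff_le)
qed simp

lemma flags_inject:
  assumes "A \<subseteq> edges (fan n)" "B \<subseteq> A"
  shows "flags n B = flags n A \<longleftrightarrow> B = A"
proof
  assume "flags n B = flags n A"
  then have *: "flag B i = flag A i" if "1 \<le> i" "i \<le> n" for i using that by (auto simp del: upt_Suc)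
  have "e \<in> B" if e: "e \<in> A" for e
  proof -
    have "e \<in> edges (fan n)" using e assms by blast
    then show ?thesis
    proof (rule fan_edgeE)
      fix i assume "1 \<le> i" "i < n" "e = {i, Suc i}"
      then show ?thesis using *[of "Suc i"] e by (simp add: flag_def)
    next
      fix i assume "1 \<le> i" "i \<le> n" "e = {0, i}"
      then show ?thesis using *[of i] e by (simp add: flag_def)
    qed
  qed
  then show "B = A" using assms by blast
qed simp

lemma loopless_fan_subgraph: "admissible n A \<Longrightarrow> loopless_graph (edge_subgraph (fan n) A)"
  by (intro loopless_edge_subgraph loopless_fan) (simp add: admissible_def)

lemma verts_fan_subgraph: "admissible n A \<Longrightarrow> verts (edge_subgraph (fan n) A) \<subseteq> {0..n}"
  using loopless_fan[of n] by (auto simp: admissible_def edge_subgraph_def loopless_graph_def verts_fan)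

lemma consistent_flags_start: "admissible n A \<Longrightarrow> consistent s (flags n A)"
  using consistent_flags[of n A 1 n s] by simp

text \<open>Compare two counts of the \<open>2\<close>-colourings in which all edges are monochromatic: by the rank, and
  vertex by vertex.\<close>

lemma rk_fan_subgraph:
  assumes "admissible n A"
  shows "rk (edge_subgraph (fan n) A) = attached (flags n A)"
proof -
  let ?H = "edge_subgraph (fan n) A"
  have sub: "A \<subseteq> edges (fan n)" using assms by (simp add: admissible_def)
  have "(2::nat) ^ (card {0..n} - rk ?H) = card {f \<in> {0..n} \<rightarrow>\<^sub>E {..<2::nat}. \<forall>e\<in>edges ?H. mono_on_set f (ends ?H e)}"
    by (rule card_colorings_rk[OF loopless_fan_subgraph[OF assms] verts_fan_subgraph[OF assms], symmetric]) simp
  also have "\<dots> = (\<Sum>f\<in>{0..n} \<rightarrow>\<^sub>E {..<2::nat}. of_bool (\<forall>e\<in>A. mono_on_set f e))"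
    by (subst sum_of_bool_eq) (auto simp: finite_PiE Int_def edge_subgraph_def)
  also have "\<dots> = (\<Sum>f\<in>{0..n} \<rightarrow>\<^sub>E {..<2::nat}. of_bool (flags n {e \<in> A. mono_on_set f e} = flags n A))"
  proof (intro sum.cong refl)
    fix f :: "nat \<Rightarrow> nat"
    have "flags n {e \<in> A. mono_on_set f e} = flags n A \<longleftrightarrow> {e \<in> A. mono_on_set f e} = A"
      by (rule flags_inject[OF sub]) auto
    then show "of_bool (\<forall>e\<in>A. mono_on_set f e) = (of_bool (flags n {e \<in> A. mono_on_set f e} = flags n A) :: nat)"
      by auto
  qed
  also have "\<dots> = (\<Sum>c0<2. \<Sum>ws\<in>words 2 (length (flags n A)). of_bool (recolor c0 c0 (flags n A) ws = flags n A))"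
    by (rule sum_fan_colorings)
  also have "\<dots> = (\<Sum>c0<(2::nat). 2 ^ (length (flags n A) - attached (flags n A)))"
    by (intro sum.cong refl count_fitting_words[OF consistent_flags_start[OF assms]]) auto
  also have "\<dots> = 2 ^ Suc (n - attached (flags n A))" by (simp del: upt_Suc)
  finally have "Suc n - rk ?H = Suc (n - attached (flags n A))"
    by (subst (asm) power_inject_exp) auto
  then show ?thesis using attached_le[of "flags n A"] by (simp del: upt_Suc)
qed

lemma fan_Q_edge_subgraph: "fan_Q n (edge_subgraph G A) = block_prod block_KL True 0 (flags n A)"
  by (simp add: fan_Q_def edge_subgraph_def)

lemma run_wt_fan_Q:
  assumes "admissible n B"
  shows "(- real k) ^ rk (edge_subgraph (fan n) B) * eval_real (fan_Q n (edge_subgraph (fan n) B)) (inverse (real k))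
    = block_prod (run_wt k) True 0 (flags n B)"
proof -
  have "run_wt k = (\<lambda>s r. (- real k) ^ block_rk s r * eval_real (block_KL s r) (inverse (real k)))"
    by (intro ext) (simp add: run_wt_def block_rk_def block_KL_def)
  then show ?thesis
    using block_prod_power_rk[of True 0 "- real k" "flags n B"]
    by (simp add: fan_Q_edge_subgraph rk_fan_subgraph[OF assms] block_prod_mult eval_real_block_prod
        block_rk_def del: upt_Suc)
qed

lemma fan_wt_fan_Q:
  assumes "admissible n A"
  shows "block_prod (fan_wt k) True 0 (flags n A) = (- 1) ^ rk (edge_subgraph (fan n) A) *
     real k ^ (n - rk (edge_subgraph (fan n) A)) * eval_real (fan_Q n (edge_subgraph (fan n) A)) (real k)"
proof -
  have "fan_wt k = (\<lambda>s r. ((- 1) ^ block_rk s r * (if s \<or> r = 0 then 1 else real k)) * eval_real (block_KL s r) (real k))"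
    by (intro ext) (auto simp: fan_wt_def block_rk_def block_KL_def fan_KL_def[of 0])
  then show ?thesis
    using block_prod_power_rk[of True 0 "- 1 :: real" "flags n A"] block_prod_free[of True 0 "real k" "flags n A"]
    by (simp add: fan_Q_edge_subgraph rk_fan_subgraph[OF assms] block_prod_mult eval_real_block_prod
        block_rk_def del: upt_Suc)
qed

text \<open>The statement is the degree bound in a form that survives products: a factor of rank \<open>0\<close> is
  trivial, and any other factor satisfies the strict inequality.\<close>

lemma degree_block_prod:
  fixes xs defines "p \<equiv> \<lambda>s r. block_prod block_KL s r xs"
  shows "s \<or> r > 0 \<Longrightarrow> 2 * degree (p s r) < block_rk s r + attached xs \<or>
    p s r = 1 \<and> block_rk s r + attached xs = 0"
  unfolding p_def
proof (induction xs arbitrary: s r)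
  case Nil
  then show ?case using degree_fan_KL[of r]
    by (cases "r = 0") (auto simp: block_rk_def block_KL_def fan_KL_def[of 0])
next
  case (Cons x xs)
  obtain s' l where x: "x = (s', l)" by (cases x)
  show ?case
  proof (cases l)
    case True
    have "block_rk s (Suc r) = Suc (block_rk s r)" using Cons.prems by (auto simp: block_rk_def)
    then show ?thesis using Cons.IH[of s "Suc r"] True by (simp add: x)
  next
    case False
    let ?p = "block_KL s r" and ?q = "block_prod block_KL s' 1 xs"
    have "2 * degree ?p < block_rk s r \<or> ?p = 1 \<and> block_rk s r = 0"
      using Cons.prems degree_fan_KL[of r]
      by (cases "r = 0") (auto simp: block_rk_def block_KL_def fan_KL_def[of 0])
    moreover have "2 * degree ?q < (if s' then 1 else 0) + attached xs \<or>
        ?q = 1 \<and> (if s' then 1 else 0) + attached xs = 0"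
      using Cons.IH[of s' 1] by (cases s') (auto simp: block_rk_def)
    ultimately show ?thesis using False degree_mult_le[of ?p ?q] by (auto simp: x)
  qed
qed

section \<open>The inverse Kazhdan--Lusztig polynomial of the fan\<close>

lemma admissible_KL:
  assumes A: "admissible n A"
  shows "inverse_KL_conditions (fan_Q n) (edge_subgraph (fan n) A)"
proof (rule inverse_KL_conditions_by_coloring)
  let ?H = "edge_subgraph (fan n) A"
  have deg: "2 * degree (fan_Q n ?H) < rk ?H \<or> fan_Q n ?H = 1 \<and> rk ?H = 0"
    using degree_block_prod[of True 0 "flags n A"]
    by (simp add: fan_Q_edge_subgraph rk_fan_subgraph[OF A] block_rk_def del: upt_Suc)
  show "loopless_graph ?H" by (rule loopless_fan_subgraph[OF A])
  show "fan_Q n ?H = 1" if "rk ?H = 0" using deg that by auto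
  show "2 * degree (fan_Q n ?H) < rk ?H" if "rk ?H > 0" using deg that by auto
  fix k :: nat assume k: "k > 0"
  define V where "V = verts ?H"
  define h where "h B = (- real k) ^ rk (edge_subgraph ?H B) * eval_real (fan_Q n (edge_subgraph ?H B)) (inverse (real k))" for B
  have V: "V \<subseteq> {0..n}" unfolding V_def by (rule verts_fan_subgraph[OF A])
  have rest: "mono_edges ?H (restrict f V) = mono_edges ?H f" for f :: "nat \<Rightarrow> nat"
  proof -
    have "mono_on_set (restrict f V) e = mono_on_set f e" if "e \<in> A" for e
    proof -
      have "e \<subseteq> V" using that by (auto simp: V_def edge_subgraph_def)
      then have "restrict f V v = f v" if "v \<in> e" for v using that by auto
      then show ?thesis by (simp add: mono_on_set_def)
    qed
    then show ?thesis unfolding mono_edges_edge_subgraph by auto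
  qed
  have "real k ^ (Suc n - card V) * (\<Sum>f\<in>V \<rightarrow>\<^sub>E {..<k}. h (mono_edges ?H f)) =
      (\<Sum>f\<in>{0..n} \<rightarrow>\<^sub>E {..<k}. h (mono_edges ?H f))"
    using sum_colorings_extend[OF _ V, of "{..<k}" "\<lambda>f. h (mono_edges ?H f)"] V finite_subset[OF V]
    by (simp add: rest card_Diff_subset)
  also have "\<dots> = (\<Sum>f\<in>{0..n} \<rightarrow>\<^sub>E {..<k}. block_prod (run_wt k) True 0 (flags n {e \<in> A. mono_on_set f e}))"
    by (intro sum.cong refl)
      (simp add: h_def edge_subgraph_edge_subgraph mono_edges_edge_subgraph run_wt_fan_Q[OF admissible_mono[OF A]] del: upt_Suc)
  also have "\<dots> = (\<Sum>c0<k. \<Sum>ws\<in>words k (length (flags n A)). block_prod (run_wt k) True 0 (recolor c0 c0 (flags n A) ws))"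
    by (rule sum_fan_colorings)
  also have "\<dots> = (\<Sum>c0<k. block_prod (fan_wt k) True 0 (flags n A))"
    by (intro sum.cong refl sum_words_block_prod[OF _ starts_block_flags consistent_flags_start[OF A, of True]]) simp
  also have "\<dots> = real k * ((- 1) ^ rk ?H * real k ^ (n - rk ?H) * eval_real (fan_Q n ?H) (real k))"
    unfolding fan_wt_fan_Q[OF A] by simp
  also have "\<dots> = real k ^ (Suc n - card V) * ((- 1) ^ rk ?H * real k ^ (card V - rk ?H) * eval_real (fan_Q n ?H) (real k))"
  proof -
    have "rk ?H \<le> n" using rk_fan_subgraph[OF A] attached_le[of "flags n A"] by (simp del: upt_Suc)
    moreover have "rk ?H \<le> card V" by (simp add: rk_def V_def)
    moreover have "card V \<le> Suc n" using card_mono[OF _ V] by simp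
    ultimately have "Suc (n - rk ?H) = (Suc n - card V) + (card V - rk ?H)" by simp
    then have "real k * real k ^ (n - rk ?H) = real k ^ (Suc n - card V) * real k ^ (card V - rk ?H)"
      by (metis power_Suc power_add)
    then show ?thesis by (simp add: mult_ac)
  qed
  finally show "(- 1) ^ rk ?H * real k ^ (card (verts ?H) - rk ?H) * eval_real (fan_Q n ?H) (real k) =
      (\<Sum>f\<in>verts ?H \<rightarrow>\<^sub>E {..<k}. (- real k) ^ rk (edge_subgraph ?H (mono_edges ?H f)) *
         eval_real (fan_Q n (edge_subgraph ?H (mono_edges ?H f))) (inverse (real k)))"
    using k by (simp add: V_def h_def)
qed

text \<open>If a path edge lies in the flat, then both its ends belong to one part, and the hub belongs to that
  part or not.\<close>

lemma admissible_flat: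
  assumes A: "admissible n A" and C: "C \<in> compositions (edge_subgraph (fan n) A)"
  shows "admissible n (flat_of (edge_subgraph (fan n) A) C)"
proof -
  let ?H = "edge_subgraph (fan n) A"
  have part: "partition_on (verts ?H) C" using C by (simp add: compositions_def)
  have flat: "e \<in> flat_of ?H C \<longleftrightarrow> e \<in> A \<and> (\<exists>P\<in>C. e \<subseteq> P)" for e
    by (simp add: flat_of_def edge_subgraph_def)
  have same: "\<exists>P\<in>C. {a, c} \<subseteq> P" if "P \<in> C" "{b, c} \<subseteq> P" "P' \<in> C" "{a, b} \<subseteq> P'" for a b c P P'
    using partition_unique_part[OF part that(1,3), of b] that by blast
  show ?thesis unfolding admissible_def
  proof (intro conjI allI impI)
    show "flat_of ?H C \<subseteq> edges (fan n)" using A flat by (auto simp: admissible_def)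
    fix i assume i: "1 \<le> i \<and> i < n \<and> {i, Suc i} \<in> flat_of ?H C"
    then obtain P where P: "P \<in> C" "{i, Suc i} \<subseteq> P" using flat by blast
    have "{0, i} \<in> A \<longleftrightarrow> {0, Suc i} \<in> A" using A i flat by (auto simp: admissible_def)
    moreover have "(\<exists>P\<in>C. {0, i} \<subseteq> P) \<longleftrightarrow> (\<exists>P\<in>C. {0, Suc i} \<subseteq> P)"
    proof -
      have P2: "{Suc i, i} \<subseteq> P" using P by auto
      have "\<exists>P\<in>C. {0, Suc i} \<subseteq> P" if "Q \<in> C" "{0, i} \<subseteq> Q" for Q
        by (rule same[OF P that])
      moreover have "\<exists>P\<in>C. {0, i} \<subseteq> P" if "Q \<in> C" "{0, Suc i} \<subseteq> Q" for Q
        by (rule same[OF P(1) P2 that])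
      ultimately show ?thesis by (metis (no_types, lifting))
    qed
    ultimately show "{0, i} \<in> flat_of ?H C \<longleftrightarrow> {0, Suc i} \<in> flat_of ?H C"
      unfolding flat by blast
  qed
qed

lemma fan_Q_fan: "fan_Q n (fan n) = fan_KL n"
proof (cases n)
  case 0
  then show ?thesis by (simp add: fan_Q_def block_KL_def)
next
  case (Suc m)
  have rep: "block_prod block_KL True r (replicate N (True, True)) = fan_KL (r + N)" for r N
    by (induction N arbitrary: r) (auto simp: block_KL_def)
  have "flag (edges (fan n)) i = (True, True)" if "i \<in> {2..<Suc n}" for i
  proof -
    have "{i - 1, i} = {i - 1, (i - 1) + 1}" using that by auto
    then have "{i - 1, i} \<in> edges (fan n)" using that unfolding fan_def
      by (simp, intro disjI1 exI[of _ "i - 1"]) auto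
    then show ?thesis using that by (auto simp: flag_def fan_def)
  qed
  then have "map (flag (edges (fan n))) [2..<Suc n] = map (\<lambda>_. (True, True)) [2..<Suc n]"
    by (intro map_cong refl) (simp del: upt_Suc)
  also have "\<dots> = replicate m (True, True)" by (simp add: map_replicate_const Suc del: upt_Suc)
  finally have tail: "map (flag (edges (fan n))) [2..<Suc n] = replicate m (True, True)" .
  have "flag (edges (fan n)) 1 = (True, False)"
    using spoke_in_fan[of 1 n] Suc by (simp add: flag_def)
  moreover have "[1..<Suc n] = 1 # [2..<Suc n]"
    using Suc by (simp add: upt_conv_Cons numeral_2_eq_2 del: upt_Suc)
  ultimately have "flags n (edges (fan n)) = (True, False) # replicate m (True, True)"
    by (simp only: list.map tail)
  then show ?thesis using rep[of 1 m] by (simp add: fan_Q_def block_KL_def fan_KL_def[of 0] Suc del: upt_Suc)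
qed

text \<open>Existence comes from the class of admissible subgraphs; any other class on which the conditions
  hold is compared with it at the fan.\<close>

lemma inverse_KL_poly_fan:
  assumes "n \<ge> 1"
  shows "inverse_KL_poly (fan n) = fan_KL n"
proof -
  define \<A> where "\<A> = {edge_subgraph (fan n) A | A. admissible n A}"
  have cls: "loopless_graph H \<and> (\<forall>C\<in>compositions H. restriction H C \<in> \<A>) \<and> inverse_KL_conditions (fan_Q n) H"
    if "H \<in> \<A>" for H
    using that admissible_flat admissible_KL loopless_fan_subgraph
    unfolding \<A>_def restriction_eq_edge_subgraph by (auto simp: edge_subgraph_edge_subgraph)
  have mem: "fan n \<in> \<A>"
    using fan_eq_edge_subgraph[OF assms] admissible_edges unfolding \<A>_def by (metis (mono_tags, lifting) mem_Collect_eq)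
  have cov: "verts (fan n) = (\<Union>e\<in>edges (fan n). ends (fan n) e)"
    using fan_eq_edge_subgraph[OF assms] by (metis edge_subgraph_def mgraph.select_convs(1))
  show ?thesis unfolding inverse_KL_poly_def
  proof (rule the_equality)
    show "\<exists>\<G> Q. fan n \<in> \<G> \<and> (\<forall>H\<in>\<G>. loopless_graph H \<and> (\<forall>C\<in>compositions H. restriction H C \<in> \<G>) \<and>
           inverse_KL_conditions Q H) \<and> fan_KL n = Q (fan n)"
      by (intro exI[of _ \<A>] exI[of _ "fan_Q n"] conjI ballI mem) (use cls fan_Q_fan in auto)
  next
    fix q
    assume "\<exists>\<G> Q. fan n \<in> \<G> \<and> (\<forall>H\<in>\<G>. loopless_graph H \<and> (\<forall>C\<in>compositions H. restriction H C \<in> \<G>) \<and>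
           inverse_KL_conditions Q H) \<and> q = Q (fan n)"
    then obtain \<G> Q where *: "fan n \<in> \<G>" "\<forall>H\<in>\<G>. loopless_graph H \<and> (\<forall>C\<in>compositions H. restriction H C \<in> \<G>) \<and>
           inverse_KL_conditions Q H" "q = Q (fan n)" by blast
    have "Q (fan n) = fan_Q n (fan n)"
      by (rule inverse_KL_unique[OF bspec[OF *(2)] cls *(1) mem cov])
    then show "q = fan_KL n" using * fan_Q_fan by simp
  qed
qed

theorem theorem1p2:
  fixes n :: nat
  assumes "n \<ge> 1"
  shows "log_concave_coeffs (inverse_KL_poly (fan n)) \<and>
         no_internal_zeros (inverse_KL_poly (fan n))"
  unfolding inverse_KL_poly_fan[OF assms]
  using log_concave_fan_KL no_internal_zeros_fan_KL by blast

end
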